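(* Let $V_0,\dots,V_\ell$ be analytic vector fields on $\mathbb R^N$. For any letter $i^{(m)}\in\mathbb A$, $m\ge 1$, the differential operator $$V_{i^{(m)}}:=\bar\mu\big((\overline i^{(m)})^0\big)$$ is a vector field (i.e. a first-order differential operator without zeroth-order term). More precisely, $V_{i^{(m)}}$ is the $m$-th component of the pre-Lie Magnus expansion of the vector field $V_i\cdot\partial=V_{i^{(1)}}$, that is, $$V_{i^{(m)}}=\Omega^{\triangleright}_m(V_i).$$
   Context: Fix integers $0\le d\le \ell$ and $N\ge1$. The alphabet is $\mathbb A=\{0,1,\dots,\ell\}\cup\{i^{(2)}:1\le i\le d\}\cup\{i^{(m)}:d+1\le i\le\ell,\ m\ge2\}$, and we write $i^{(1)}:=i$. Bracket product: the commutative associative bilinear product $[\cdot,\cdot]$ on the real vector space spanned by $\mathbb A$ given by: $[0,a]=0$ (the zero vector) for all letters $a$; $[i,i]=i^{(2)}$ and $[i,i^{(2)}]=0$ for $1\le i\le d$ (hence also $[i^{(2)},i^{(2)}]=0$); $[i^{(p)},i^{(q)}]=i^{(p+q)}$ for $d+1\le i\le \ell$, $p,q\ge1$; $[i^{(p)},j^{(q)}]=0$ for $i\ne j$. Iterated products: $[a_1,\dots,a_n]=[a_1,[a_2,\dots,a_n]]$, and for $n=1$ it is $a_1$. $\overline{\mathbb A}=\{\overline a:a\in\mathbb A\}$ is a copy of $\mathbb A$, and $\mathbb R\langle\overline{\mathbb A}\rangle$ is the free associative unital algebra on $\overline{\mathbb A}$ (concatenation product). For $a\in\mathbb A$, $$\overline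 a^0:=\sum_{n\ge1}\frac{(-1)^{n-1}}{n}\sum_{[a_1,\dots,a_n]=a}\overline a_1\cdots\overline a_n\in\mathbb R\langle\overline{\mathbb A}\rangle,$$ the inner sum (finite, and empty for large $n$) being over letters $a_1,\dots,a_n\in\mathbb A$. Differential operators: $V_i=(V_i^1,\dots,V_i^N)$, identified with $V_i\cdot\partial=\sum_jV_i^j\partial_j$. For $i^{(m)}\in\mathbb A$ put $D_{i^{(m)}}:=\frac1{m!}\sum_{j_1,\dots,j_m=1}^N V_i^{j_1}\cdots V_i^{j_m}\,\partial^m_{j_1\cdots j_m}$; in particular $D_{i^{(1)}}=V_i\cdot\partial$. The map $\bar\mu$ is the unital algebra morphism from $\mathbb R\langle\overline{\mathbb A}\rangle$ to differential operators on $\mathbb R^N$ (with composition) with $\bar\mu(\overline a)=D_a$. Pre-Lie product on vector fields: $V\triangleright W=\sum_{i}\big(\sum_jV^j\partial_jW^i\big)\partial_i$. Components of the pre-Lie Magnus expansion: $\Omega_1^\triangleright(a)=a$ and, for $n>1$, $$\Omega_n^\triangleright(a)=\sum_{k=1}^{n-1}\frac{B_k}{k!}\sum_{\substack{i_1,\dots,i_k\ge1\\ i_1+\cdots+i_k=n-1}}\Omega^\triangleright_{i_1}(a)\triangleright\big(\Omega^\triangleright_{i_2}(a)\triangleright(\cdots\triangleright(\Omega^\triangleright_{i_k}(a)\triangleright a))\big),$$ where $B_k$ are the Bernoulli numbers with $B_1=-\tfrac12$. *)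

theory Defs
  imports "HOL-Analysis.Analysis" "HOL-Library.Poly_Mapping"
begin

section \<open>Alphabet and bracket product\<close>

text \<open>The pair \<open>(i, m)\<close> encodes the letter \<open>i\<^sup>(\<^sup>m\<^sup>)\<close>; in particular \<open>(i, 1)\<close> is \<open>i\<close>.\<close>

type_synonym letter = "nat \<times> nat"

definition alphabet :: "nat \<Rightarrow> nat \<Rightarrow> letter set" where
  "alphabet d l = {(i, 1) |i. i \<le> l} \<union> {(i, 2) |i. 1 \<le> i \<and> i \<le> d}
     \<union> {(i, m) |i m. d + 1 \<le> i \<and> i \<le> l \<and> 2 \<le> m}"

text \<open>Vectors are elements of \<open>letter \<Rightarrow>\<^sub>0 real\<close>. The bracket of two letters is again a letter or
  the zero vector; the latter is encoded as \<open>None\<close>.\<close>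

definition letter_bracket :: "nat \<Rightarrow> letter \<Rightarrow> letter \<Rightarrow> letter option" where
  "letter_bracket d a b = (case (a, b) of ((i, p), (j, q)) \<Rightarrow>
     if i \<noteq> j \<or> i = 0 then None
     else if i \<le> d then (if p = 1 \<and> q = 1 then Some (i, 2) else None)
     else Some (i, p + q))"

definition letter_vec :: "letter \<Rightarrow> letter \<Rightarrow>\<^sub>0 real" where
  "letter_vec a = Poly_Mapping.single a 1"

definition bracket :: "nat \<Rightarrow> (letter \<Rightarrow>\<^sub>0 real) \<Rightarrow> (letter \<Rightarrow>\<^sub>0 real) \<Rightarrow> (letter \<Rightarrow>\<^sub>0 real)" where
  "bracket d u v = (\<Sum>a\<in>Poly_Mapping.keys u. \<Sum>b\<in>Poly_Mapping.keys v.
     (case letter_bracket d a b of None \<Rightarrow> 0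
      | Some c \<Rightarrow> Poly_Mapping.single c (Poly_Mapping.lookup u a * Poly_Mapping.lookup v b)))"

text \<open>The value on the empty list is irrelevant.\<close>

fun iter_bracket :: "nat \<Rightarrow> letter list \<Rightarrow> (letter \<Rightarrow>\<^sub>0 real)" where
  "iter_bracket d [] = 0"
| "iter_bracket d [a] = letter_vec a"
| "iter_bracket d (a # b # w) = bracket d (letter_vec a) (iter_bracket d (b # w))"

definition bracket_words :: "nat \<Rightarrow> nat \<Rightarrow> nat \<Rightarrow> letter \<Rightarrow> letter list set" where
  "bracket_words d l n a =
     {w. length w = n \<and> set w \<subseteq> alphabet d l \<and> iter_bracket d w = letter_vec a}"

lemma keys_letter_vec [simp]: "Poly_Mapping.keys (letter_vec a) = {a}"
  by (simp add: letter_vec_def)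

lemma lookup_letter_vec [simp]: "Poly_Mapping.lookup (letter_vec a) a = 1"
  by (simp add: letter_vec_def)

lemma letter_vec_eq_iff [simp]: "letter_vec a = letter_vec b \<longleftrightarrow> a = b"
  by (metis keys_letter_vec singleton_inject)

lemma letter_vec_neq_0 [simp]: "letter_vec a \<noteq> 0" "0 \<noteq> letter_vec a"
  by (metis keys_letter_vec keys_zero insert_not_empty)+

lemma bracket_letter_vec:
  "bracket d (letter_vec a) (letter_vec b) =
     (case letter_bracket d a b of None \<Rightarrow> 0 | Some c \<Rightarrow> letter_vec c)"
  by (simp add: bracket_def split: option.split) (simp add: letter_vec_def)

lemma bracket_0_right [simp]: "bracket d u 0 = 0"
  by (simp add: bracket_def)

lemma iter_bracket_cases:
  assumes "w \<noteq> []"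
  shows "iter_bracket d w = 0 \<or>
    (\<exists>i. iter_bracket d w = letter_vec (i, sum_list (map snd w)) \<and> (\<forall>a\<in>set w. fst a = i))"
  using assms
proof (induction d w rule: iter_bracket.induct)
  case (2 d a)
  then show ?case by (cases a) simp
next
  case (3 d a b w)
  consider "iter_bracket d (b # w) = 0"
    | i where "iter_bracket d (b # w) = letter_vec (i, sum_list (map snd (b # w)))"
        "\<forall>a\<in>set (b # w). fst a = i"
    using 3 by blast
  then show ?case
  proof cases
    case 2
    then show ?thesis
      by (cases a) (auto simp: bracket_letter_vec letter_bracket_def split: option.splits if_splits)
  qed simp
qed simp

text \<open>The index sets of the two sums in \<open>bar0\<close> below are finite, so neither sum degenerates.\<close>

lemma bracket_words_subset:
  assumes "w \<in> bracket_words d l n (i, m)" "n \<ge> 1"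
  shows "n \<le> m" "set w \<subseteq> {i} \<times> {..m}"
proof -
  from assms have ne: "w \<noteq> []" and len: "length w = n" and sub: "set w \<subseteq> alphabet d l"
    and eq: "iter_bracket d w = letter_vec (i, m)"
    by (auto simp: bracket_words_def)
  from iter_bracket_cases[OF ne, of d] eq
  have m: "sum_list (map snd w) = m" and i: "\<forall>a\<in>set w. fst a = i"
    by auto
  have pos: "\<forall>a\<in>set w. 1 \<le> snd a"
    using sub by (auto simp: alphabet_def)
  have "length w \<le> sum_list (map snd w)" if "\<forall>a\<in>set w. 1 \<le> snd a" for w :: "letter list"
    using that by (induction w) auto
  with pos m len show "n \<le> m" by blast
  have "snd a \<le> m" if "a \<in> set w" for a
    using that m member_le_sum_list[of "snd a" "map snd w"] by auto
  with i show "set w \<subseteq> {i} \<times> {..m}" by (metis atMost_iff insertI1 mem_Times_iff subsetI)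
qed

lemma finite_bracket_words:
  assumes "n \<ge> 1"
  shows "finite (bracket_words d l n a)"
proof (cases a)
  case (Pair i m)
  have "finite {w. set w \<subseteq> {i} \<times> {..m} \<and> length w = n}"
    by (intro finite_lists_length_eq) simp
  moreover have "bracket_words d l n a \<subseteq> {w. set w \<subseteq> {i} \<times> {..m} \<and> length w = n}"
  proof
    fix w assume w: "w \<in> bracket_words d l n a"
    then have "length w = n" by (simp add: bracket_words_def)
    with w bracket_words_subset(2)[OF _ assms] show "w \<in> {w. set w \<subseteq> {i} \<times> {..m} \<and> length w = n}"
      unfolding Pair by blast
  qed
  ultimately show ?thesis by (rule rev_finite_subset)
qed

lemma finite_bracket_lengths: "finite {n. 1 \<le> n \<and> bracket_words d l n a \<noteq> {}}"
proof (cases a)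
  case (Pair i m)
  have "{n. 1 \<le> n \<and> bracket_words d l n a \<noteq> {}} \<subseteq> {..m}"
    unfolding Pair using bracket_words_subset(1) by blast
  then show ?thesis by (rule finite_subset) simp
qed


section \<open>The free algebra\<close>

text \<open>Words form a monoid under concatenation (written additively, as \<open>Poly_Mapping\<close> requires),
  and \<open>letter list \<Rightarrow>\<^sub>0 real\<close> with its convolution product is the free associative unital algebra.
  The barred copy of the alphabet is identified with the alphabet itself.\<close>

instantiation list :: (type) monoid_add
begin

definition zero_list :: "'a list" where "zero_list = []"
definition plus_list :: "'a list \<Rightarrow> 'a list \<Rightarrow> 'a list" where "plus_list u v = u @ v"

instance
  by standard (simp_all add: zero_list_def plus_list_def)

end

type_synonym free_alg = "letter list \<Rightarrow>\<^sub>0 real"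

definition scalar :: "real \<Rightarrow> free_alg" where
  "scalar c = Poly_Mapping.single [] c"

definition bar :: "letter \<Rightarrow> free_alg" where
  "bar a = Poly_Mapping.single [a] 1"

lemma prod_list_bar: "prod_list (map bar w) = Poly_Mapping.single w 1"
proof (induction w)
  case Nil
  show ?case using single_one[where 'a = "letter list" and 'b = real] by (simp add: zero_list_def)
next
  case (Cons a w)
  then show ?case by (simp add: bar_def mult_single plus_list_def)
qed

lemma free_alg_induct [case_names single sum]:
  fixes P :: free_alg
  assumes "\<And>w c. Q (Poly_Mapping.single w c)" "\<And>P1 P2. Q P1 \<Longrightarrow> Q P2 \<Longrightarrow> Q (P1 + P2)"
  shows "Q P"
proof (induction P rule: update_induct)
  case const
  show ?case using assms(1)[of "[]" 0] by simp
next
  case (update P w c)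
  have "Poly_Mapping.update w c P = P + Poly_Mapping.single w c"
    using update.hyps(1)
    by (intro poly_mapping_eqI) (auto simp: lookup_update lookup_add lookup_single in_keys_iff when_def)
  then show ?case using assms update.IH by simp
qed

text \<open>The element written with a bar and a superscript \<open>0\<close>.\<close>

definition bar0 :: "nat \<Rightarrow> nat \<Rightarrow> letter \<Rightarrow> free_alg" where
  "bar0 d l a = (\<Sum>n | 1 \<le> n \<and> bracket_words d l n a \<noteq> {}.
     scalar ((- 1) ^ (n - 1) / real n) * (\<Sum>w\<in>bracket_words d l n a. prod_list (map bar w)))"


section \<open>Smooth and analytic functions, differential operators\<close>

definition partial :: "'n \<Rightarrow> (real^'n \<Rightarrow> real) \<Rightarrow> real^'n \<Rightarrow> real" where
  "partial j f x = deriv (\<lambda>t. f (x + t *\<^sub>R axis j 1)) 0"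

text \<open>\<open>C\<^sup>\<infinity>\<close>: all iterated partial derivatives (including \<open>f\<close> itself) are differentiable, hence
  continuous.\<close>

definition smooth :: "(real^'n \<Rightarrow> real) \<Rightarrow> bool" where
  "smooth f \<longleftrightarrow> (\<forall>js. foldr partial js f differentiable_on UNIV)"

text \<open>Real analyticity on the whole space: local expansion into an (unconditionally, hence
  absolutely) convergent power series indexed by multi-indices.\<close>

definition real_analytic :: "(real^'n \<Rightarrow> real) \<Rightarrow> bool" where
  "real_analytic f \<longleftrightarrow> (\<forall>x. \<exists>r>0. \<exists>c :: ('n \<Rightarrow> nat) \<Rightarrow> real. \<forall>y\<in>ball x r.
     ((\<lambda>\<alpha>. c \<alpha> * (\<Prod>j\<in>UNIV. (y $ j - x $ j) ^ \<alpha> j)) has_sum f y) UNIV)"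

type_synonym 'n vfield = "real^'n \<Rightarrow> real^'n"

definition analytic_vfield :: "('n::finite) vfield \<Rightarrow> bool" where
  "analytic_vfield W \<longleftrightarrow> (\<forall>i. real_analytic (\<lambda>x. W x $ i))"

text \<open>Differential operators are represented by their action on smooth functions; their values on
  other functions carry no meaning.\<close>

type_synonym 'n operator = "(real^'n \<Rightarrow> real) \<Rightarrow> real^'n \<Rightarrow> real"

definition op_eq :: "('n::finite) operator \<Rightarrow> 'n operator \<Rightarrow> bool" where
  "op_eq P Q \<longleftrightarrow> (\<forall>f. smooth f \<longrightarrow> P f = Q f)"

definition vfield_op :: "('n::finite) vfield \<Rightarrow> 'n operator" where
  "vfield_op W f x = (\<Sum>j\<in>UNIV. W x $ j * partial j f x)"

text \<open>The coefficients are required to be analytic, as for the given vector fields.\<close>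

definition is_vfield :: "('n::finite) operator \<Rightarrow> bool" where
  "is_vfield P \<longleftrightarrow> (\<exists>W. analytic_vfield W \<and> op_eq P (vfield_op W))"

definition letter_op :: "(nat \<Rightarrow> ('n::finite) vfield) \<Rightarrow> letter \<Rightarrow> 'n operator" where
  "letter_op V a f x = (case a of (i, m) \<Rightarrow>
     1 / fact m * (\<Sum>js | length js = m. (\<Prod>j\<leftarrow>js. V i x $ j) * foldr partial js f x))"

definition mu_bar :: "(nat \<Rightarrow> ('n::finite) vfield) \<Rightarrow> free_alg \<Rightarrow> 'n operator" where
  "mu_bar V P f x =
     (\<Sum>w\<in>Poly_Mapping.keys P. Poly_Mapping.lookup P w * foldr (letter_op V) w f x)"


section \<open>\<open>mu_bar\<close> is a morphism\<close>

text \<open>For smooth vector fields, \<open>mu_bar\<close> is indeed the unital algebra morphism extending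
  \<open>letter_op\<close>.\<close>

lemma smooth_differentiable: "smooth f \<Longrightarrow> f differentiable at x"
  by (metis UNIV_I differentiable_on_def foldr.simps(1) id_apply smooth_def)

lemma smooth_partial: "smooth f \<Longrightarrow> smooth (partial j f)"
  unfolding smooth_def
proof
  fix js assume "\<forall>js. foldr partial js f differentiable_on UNIV"
  then have "foldr partial (js @ [j]) f differentiable_on UNIV" by blast
  then show "foldr partial js (partial j f) differentiable_on UNIV" by simp
qed

lemma smooth_foldr_partial: "smooth f \<Longrightarrow> smooth (foldr partial js f)"
  by (induction js) (auto simp: smooth_partial)

lemma line_has_derivative:
  fixes f :: "real^'n \<Rightarrow> real"
  assumes "f differentiable at x"
  shows "((\<lambda>t. f (x + t *\<^sub>R axis j 1)) has_field_derivative partial j f x) (at 0)"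
proof -
  have "f differentiable at (x + 0 *\<^sub>R axis j 1)"
    using assms by simp
  then have "(f \<circ> (\<lambda>t. x + t *\<^sub>R axis j 1)) differentiable at (0::real)"
    by (intro differentiable_chain_at derivative_intros) auto
  then have "(\<lambda>t. f (x + t *\<^sub>R axis j 1)) differentiable at (0::real)"
    by (simp add: o_def)
  then show ?thesis
    unfolding partial_def
    by (metis DERIV_deriv_iff_real_differentiable)
qed

lemma partial_add:
  assumes "f differentiable at x" "g differentiable at x"
  shows "partial j (\<lambda>x. f x + g x) x = partial j f x + partial j g x"
  unfolding partial_def[of j "\<lambda>x. f x + g x"]
  by (rule DERIV_imp_deriv) (intro DERIV_add line_has_derivative assms)

lemma partial_mult:
  assumes "f differentiable at x" "g differentiable at x"
  shows "partial j (\<lambda>x. f x * g x) x = partial j f x * g x + f x * partial j g x"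
proof -
  have "((\<lambda>t. f (x + t *\<^sub>R axis j 1) * g (x + t *\<^sub>R axis j 1)) has_field_derivative
      partial j f x * g x + f x * partial j g x) (at 0)"
    using DERIV_mult[OF line_has_derivative[OF assms(1)] line_has_derivative[OF assms(2)], of j j]
    by (simp add: algebra_simps)
  then show ?thesis
    unfolding partial_def[of j "\<lambda>x. f x * g x"] by (rule DERIV_imp_deriv)
qed

lemma partial_const: "partial j (\<lambda>x. c) = (\<lambda>x. 0)"
  by (rule ext) (simp add: partial_def)

definition smooth_upto :: "nat \<Rightarrow> (real^'n \<Rightarrow> real) \<Rightarrow> bool" where
  "smooth_upto n f \<longleftrightarrow> (\<forall>js. length js \<le> n \<longrightarrow> foldr partial js f differentiable_on UNIV)"

lemma smooth_smooth_upto: "smooth f \<longleftrightarrow> (\<forall>n. smooth_upto n f)"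
  unfolding smooth_def smooth_upto_def by auto

lemma smooth_upto_0: "smooth_upto 0 f \<longleftrightarrow> f differentiable_on UNIV"
  by (simp add: smooth_upto_def)

lemma smooth_upto_Suc: "smooth_upto (Suc n) f \<longleftrightarrow> f differentiable_on UNIV \<and> (\<forall>j. smooth_upto n (partial j f))"
proof
  assume *: "smooth_upto (Suc n) f"
  have "foldr partial js (partial j f) differentiable_on UNIV" if "length js \<le> n" for js j
    using *[unfolded smooth_upto_def, rule_format, of "js @ [j]"] that by simp
  moreover have "f differentiable_on UNIV"
    using *[unfolded smooth_upto_def, rule_format, of "[]"] by simp
  ultimately show "f differentiable_on UNIV \<and> (\<forall>j. smooth_upto n (partial j f))"
    by (simp add: smooth_upto_def)
next
  assume *: "f differentiable_on UNIV \<and> (\<forall>j. smooth_upto n (partial j f))"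
  have "foldr partial js f differentiable_on UNIV" if "length js \<le> Suc n" for js
    using that * by (cases js rule: rev_cases) (auto simp: smooth_upto_def)
  then show "smooth_upto (Suc n) f" by (simp add: smooth_upto_def)
qed

lemma smooth_upto_mono: "smooth_upto n f \<Longrightarrow> m \<le> n \<Longrightarrow> smooth_upto m f"
  by (auto simp: smooth_upto_def)

lemma smooth_upto_add: "smooth_upto n f \<Longrightarrow> smooth_upto n g \<Longrightarrow> smooth_upto n (\<lambda>x. f x + g x)"
proof (induction n arbitrary: f g)
  case 0
  then show ?case by (simp add: smooth_upto_0 differentiable_on_add)
next
  case (Suc n)
  have "partial j (\<lambda>x. f x + g x) = (\<lambda>x. partial j f x + partial j g x)" for j
    using Suc.prems by (intro ext partial_add) (auto simp: smooth_upto_Suc differentiable_on_def)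
  with Suc show ?case by (simp add: smooth_upto_Suc differentiable_on_add)
qed

lemma smooth_upto_mult: "smooth_upto n f \<Longrightarrow> smooth_upto n g \<Longrightarrow> smooth_upto n (\<lambda>x. f x * g x)"
proof (induction n arbitrary: f g)
  case 0
  then show ?case by (simp add: smooth_upto_0 differentiable_on_mult)
next
  case (Suc n)
  have "partial j (\<lambda>x. f x * g x) = (\<lambda>x. partial j f x * g x + f x * partial j g x)" for j
    using Suc.prems by (intro ext partial_mult) (auto simp: smooth_upto_Suc differentiable_on_def)
  moreover have "smooth_upto n f" "smooth_upto n g"
    using Suc.prems by (auto intro: smooth_upto_mono)
  ultimately show ?case
    using Suc by (simp add: smooth_upto_Suc smooth_upto_add differentiable_on_mult)
qed

lemma smooth_upto_const: "smooth_upto n (\<lambda>x. c)"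
  by (induction n arbitrary: c) (simp_all add: smooth_upto_0 smooth_upto_Suc partial_const)

lemma smooth_add: "smooth f \<Longrightarrow> smooth g \<Longrightarrow> smooth (\<lambda>x. f x + g x)"
  and smooth_mult: "smooth f \<Longrightarrow> smooth g \<Longrightarrow> smooth (\<lambda>x. f x * g x)"
  and smooth_const: "smooth (\<lambda>x. c)"
  by (simp_all add: smooth_smooth_upto smooth_upto_add smooth_upto_mult smooth_upto_const)

lemma smooth_sum: "(\<And>i. i \<in> I \<Longrightarrow> smooth (f i)) \<Longrightarrow> smooth (\<lambda>x. \<Sum>i\<in>I. f i x)"
  by (induction I rule: infinite_finite_induct) (auto simp: smooth_const smooth_add)

lemma smooth_prod_list: "(\<And>i. i \<in> set is \<Longrightarrow> smooth (f i)) \<Longrightarrow> smooth (\<lambda>x. \<Prod>i\<leftarrow>is. f i x)"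
  by (induction "is") (auto simp: smooth_const smooth_mult)

definition smooth_vfield :: "('n::finite) vfield \<Rightarrow> bool" where
  "smooth_vfield W \<longleftrightarrow> (\<forall>i. smooth (\<lambda>x. W x $ i))"

lemma smooth_letter_op:
  assumes "smooth_vfield (V (fst a))" "smooth f"
  shows "smooth (letter_op V a f)"
proof -
  obtain i m where a: "a = (i, m)" by (cases a)
  have "smooth (\<lambda>x. 1 / fact m *
      (\<Sum>js | length js = m. (\<Prod>j\<leftarrow>js. V i x $ j) * foldr partial js f x))"
    using assms a
    by (intro smooth_mult smooth_sum smooth_const smooth_prod_list smooth_foldr_partial)
       (auto simp: smooth_vfield_def)
  then show ?thesis by (simp add: letter_op_def[abs_def] a)
qed

lemma foldr_partial_add:
  assumes "smooth f" "smooth g"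
  shows "foldr partial js (\<lambda>x. f x + g x) = (\<lambda>x. foldr partial js f x + foldr partial js g x)"
proof (induction js)
  case (Cons j js)
  show ?case
    unfolding foldr.simps o_apply Cons.IH
    by (intro ext partial_add smooth_differentiable smooth_foldr_partial assms)
qed simp

lemma foldr_partial_cmult:
  assumes "smooth f"
  shows "foldr partial js (\<lambda>x. c * f x) = (\<lambda>x. c * foldr partial js f x)"
proof (induction js)
  case (Cons j js)
  show ?case
    unfolding foldr.simps o_apply Cons.IH
    by (rule ext, subst partial_mult)
       (auto simp: partial_const intro: smooth_differentiable smooth_foldr_partial assms)
qed simp

lemma letter_op_add:
  "smooth f \<Longrightarrow> smooth g \<Longrightarrow>
    letter_op V a (\<lambda>x. f x + g x) = (\<lambda>x. letter_op V a f x + letter_op V a g x)"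
  by (rule ext)
     (simp add: letter_op_def foldr_partial_add algebra_simps sum.distrib add_divide_distrib
       split: prod.split)

lemma letter_op_cmult:
  "smooth f \<Longrightarrow> letter_op V a (\<lambda>x. c * f x) = (\<lambda>x. c * letter_op V a f x)"
  by (rule ext)
     (simp add: letter_op_def foldr_partial_cmult algebra_simps sum_distrib_left
       split: prod.split)

context
  fixes V :: "nat \<Rightarrow> ('n::finite) vfield"
  assumes V: "\<And>i. smooth_vfield (V i)"
begin

lemma smooth_word_op: "smooth f \<Longrightarrow> smooth (foldr (letter_op V) w f)"
  by (induction w) (auto simp: smooth_letter_op V)

lemma word_op_add:
  "smooth f \<Longrightarrow> smooth g \<Longrightarrow> foldr (letter_op V) w (\<lambda>x. f x + g x) =
     (\<lambda>x. foldr (letter_op V) w f x + foldr (letter_op V) w g x)"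
  by (induction w) (auto simp: letter_op_add smooth_word_op)

lemma word_op_cmult:
  "smooth f \<Longrightarrow> foldr (letter_op V) w (\<lambda>x. c * f x) = (\<lambda>x. c * foldr (letter_op V) w f x)"
  by (induction w) (auto simp: letter_op_cmult smooth_word_op)

lemma word_op_0: "foldr (letter_op V) w (\<lambda>x. 0) = (\<lambda>x. 0)"
  using word_op_cmult[OF smooth_const, of w 0 0] by simp

lemma mu_bar_single: "mu_bar V (Poly_Mapping.single w c) f = (\<lambda>x. c * foldr (letter_op V) w f x)"
  by (rule ext) (simp add: mu_bar_def)

lemma mu_bar_bar: "mu_bar V (bar a) f = letter_op V a f"
  by (simp add: bar_def mu_bar_single)

lemma mu_bar_one: "mu_bar V 1 f = f"
proof -
  have "(1 :: free_alg) = Poly_Mapping.single [] 1"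
    using single_one[where 'a = "letter list" and 'b = real] by (simp only: zero_list_def)
  then have "mu_bar V 1 f = mu_bar V (Poly_Mapping.single [] 1) f" by (rule arg_cong)
  also have "\<dots> = f" unfolding mu_bar_single by simp
  finally show ?thesis .
qed

lemma mu_bar_0: "mu_bar V 0 f = (\<lambda>x. 0)"
  by (rule ext) (simp add: mu_bar_def)

lemma mu_bar_superset:
  assumes "finite S" "Poly_Mapping.keys P \<subseteq> S"
  shows "mu_bar V P f x = (\<Sum>w\<in>S. Poly_Mapping.lookup P w * foldr (letter_op V) w f x)"
  unfolding mu_bar_def
  by (rule sum.mono_neutral_left) (use assms in \<open>auto simp: in_keys_iff\<close>)

lemma mu_bar_add: "mu_bar V (P + Q) f = (\<lambda>x. mu_bar V P f x + mu_bar V Q f x)"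
proof
  fix x
  let ?S = "Poly_Mapping.keys P \<union> Poly_Mapping.keys Q"
  show "mu_bar V (P + Q) f x = mu_bar V P f x + mu_bar V Q f x"
    by (subst (1 2 3) mu_bar_superset[of ?S])
       (use Poly_Mapping.keys_add[of P Q] in \<open>auto simp: lookup_add algebra_simps sum.distrib\<close>)
qed

lemma smooth_mu_bar: "smooth f \<Longrightarrow> smooth (mu_bar V P f)"
  unfolding mu_bar_def[abs_def] by (intro smooth_sum smooth_mult smooth_const smooth_word_op)

lemma mu_bar_mult:
  assumes f: "smooth f"
  shows "mu_bar V (P * Q) f = mu_bar V P (mu_bar V Q f)"
proof (induction P rule: free_alg_induct)
  case (single u c)
  show ?case
  proof (induction Q rule: free_alg_induct)
    case (single v e)
    show ?case
      by (simp add: mult_single mu_bar_single plus_list_def word_op_cmult smooth_word_op f mult.assoc)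
  next
    case (sum Q1 Q2)
    then show ?case
      by (simp add: distrib_left mu_bar_add mu_bar_single word_op_add smooth_mu_bar f)
  qed
next
  case (sum P1 P2)
  then show ?case by (simp add: distrib_right mu_bar_add)
qed

end


section \<open>The pre-Lie Magnus expansion\<close>

definition prelie :: "('n::finite) vfield \<Rightarrow> 'n vfield \<Rightarrow> 'n vfield" where
  "prelie V W x = (\<chi> i. \<Sum>j\<in>UNIV. V x $ j * partial j (\<lambda>y. W y $ i) x)"

fun bernoulli :: "nat \<Rightarrow> real" where
  "bernoulli n = (if n = 0 then 1
     else - (\<Sum>k<n. real (Suc n choose k) * bernoulli k) / real (Suc n))"

declare bernoulli.simps [simp del]

lemma bernoulli_1: "bernoulli 1 = - 1 / 2"
  by (simp add: bernoulli.simps)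

definition compositions :: "nat \<Rightarrow> nat \<Rightarrow> nat list set" where
  "compositions k s = {is. length is = k \<and> (\<forall>i\<in>set is. 1 \<le> i) \<and> sum_list is = s}"

lemma finite_compositions: "finite (compositions k s)"
proof -
  have "finite {is. set is \<subseteq> {..s} \<and> length is = k}"
    by (intro finite_lists_length_eq) simp
  then show ?thesis
    by (rule rev_finite_subset) (auto simp: compositions_def member_le_sum_list)
qed

text \<open>Components are indexed from \<open>1\<close>; the value at \<open>0\<close> is irrelevant.\<close>

function magnus :: "nat \<Rightarrow> ('n::finite) vfield \<Rightarrow> 'n vfield" where
  "magnus n a = (if n = 0 then (\<lambda>x. 0) else if n = 1 then a else
     (\<lambda>x. \<Sum>k=1..n-1. (bernoulli k / fact k) *\<^sub>R
        (\<Sum>is\<in>compositions k (n - 1). foldr (\<lambda>i W. prelie (magnus i a) W) is a x)))"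
  by pat_completeness auto
termination
proof (relation "Wellfounded.measure fst")
  fix n k i :: nat and a :: "('n::finite) vfield" and "is"
  assume n: "n \<noteq> 0" and "is \<in> compositions k (n - 1)" and "i \<in> set is"
  then have "i \<le> n - 1"
    using member_le_sum_list[of i "is"] by (simp add: compositions_def)
  with n show "((i, a), (n, a)) \<in> Wellfounded.measure fst" by simp
qed simp

declare magnus.simps [simp del]

end

theory Submission
  imports Defs
begin

text \<open>
  Write \<open>D\<^sub>m\<close> for the operator of the letter \<open>i\<^sup>(\<^sup>m\<^sup>)\<close>, put \<open>D\<^sub>0 = id\<close> and let
  \<open>D = \<Sum>\<^sub>m t\<^sup>m D\<^sub>m\<close>. By Taylor's formula \<open>D\<close> is the formal substitution \<open>f \<mapsto> f (x + t V\<^sub>i x)\<close>. The words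
  whose iterated bracket is \<open>i\<^sup>(\<^sup>m\<^sup>)\<close> are exactly the compositions of \<open>m\<close>, written in the letters
  \<open>i\<^sup>(\<^sup>k\<^sup>)\<close> (\<open>bracket_words_eq\<close>), so the operator of the theorem is the coefficient of
  \<open>t\<^sup>m\<close> in \<open>log D\<close>. Hence, with \<open>\<Omega> = \<Sum>\<^sub>m t\<^sup>m \<Omega>\<^sub>m\<close> the Magnus expansion of \<open>V\<^sub>i\<close>, the claim is
  \<open>exp \<Omega> = D\<close>: the formal flow of the vector field \<open>\<Omega>\<close> at time one is translation by \<open>t V\<^sub>i\<close>.

  On the coordinate functions this is the definition of \<open>\<Omega>\<close>. The Magnus recursion says
  \<open>\<Omega> = (L / (exp L - 1)) (t V\<^sub>i)\<close> where \<open>L = \<Omega> \<triangleright> \<cdot>\<close>, and \<open>L\<close> is the derivation \<open>\<Omega>\<close> applied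
  to each component; inverting the series gives
  \<open>exp \<Omega> x\<^sub>j = x\<^sub>j + ((exp L - 1) / L) \<Omega>\<^sub>j = x\<^sub>j + t V\<^sub>i\<^sub>j\<close>.

  To pass from coordinates to all smooth functions, let \<open>\<delta> = t d/dt\<close>. Then
  \<open>exp (- \<Omega>) \<delta> exp \<Omega> = \<delta> + \<Psi>\<close>, where \<open>\<Psi>\<close> is a series of iterated commutators of \<open>\<delta>\<close> with
  \<open>\<Omega>\<close>, hence a vector field, because the partial derivatives of a smooth function commute.
  As \<open>exp \<Omega>\<close> is multiplicative (the exponential of a derivation),
  \<open>\<delta> (exp \<Omega> f) = \<Sum>\<^sub>j (exp \<Omega> \<Psi>\<^sub>j) (exp \<Omega> (\<partial>\<^sub>j f))\<close> for \<open>f\<close> independent of \<open>t\<close>. The choice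
  \<open>f = x\<^sub>j\<close> identifies the first factor: it is \<open>t V\<^sub>i\<^sub>j\<close>. So the coefficients of \<open>exp \<Omega> f\<close>
  satisfy \<open>n c\<^sub>n(f) = \<Sum>\<^sub>j V\<^sub>i\<^sub>j c\<^sub>n\<^sub>-\<^sub>1(\<partial>\<^sub>j f)\<close>, which is the recursion that determines
  \<open>D\<^sub>n f\<close> (\<open>flow_const_eq_taylor\<close>).

  All this is algebra in \<open>A[[t]]\<close> for a commutative algebra \<open>A\<close> with commuting derivations and
  coordinates; its outcome is \<open>log_taylor_eq_magnus\<close>, which is then read off for \<open>A\<close> the algebra of
  smooth functions. The analytic half shows that real analytic functions are smooth and closed under
  sums, products and partial derivatives, so that the Magnus components are analytic vector fields.
\<close>

section \<open>Power series and the order of vanishing\<close>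

unbundle no vec_syntax
unbundle fps_syntax

definition vanishes_below :: "nat \<Rightarrow> 'a::zero fps \<Rightarrow> bool" where
  "vanishes_below k F \<longleftrightarrow> (\<forall>i<k. F $ i = 0)"

lemma vanishes_below_mono: "vanishes_below k F \<Longrightarrow> j \<le> k \<Longrightarrow> vanishes_below j F"
  by (simp add: vanishes_below_def)

lemma vanishes_below_iff:
  fixes F :: "'a::comm_ring_1 fps"
  shows "vanishes_below k F \<longleftrightarrow> (\<exists>G. F = fps_X ^ k * G)"
proof
  assume F: "vanishes_below k F"
  have "F = fps_X ^ k * fps_shift k F"
    using F by (intro fps_ext) (auto simp: fps_X_power_mult_nth vanishes_below_def)
  then show "\<exists>G. F = fps_X ^ k * G" ..
qed (auto simp: vanishes_below_def fps_X_power_mult_nth)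

lemma vanishes_below_mult:
  fixes F G :: "'a::comm_ring_1 fps"
  assumes "vanishes_below k F" "vanishes_below l G"
  shows "vanishes_below (k + l) (F * G)"
proof -
  obtain F' G' where "F = fps_X ^ k * F'" "G = fps_X ^ l * G'"
    using assms vanishes_below_iff by blast
  then have "F * G = fps_X ^ (k + l) * (F' * G')"
    by (simp add: power_add algebra_simps)
  then show ?thesis using vanishes_below_iff by blast
qed

lemma vanishes_below_sum:
  "(\<And>j. j \<in> J \<Longrightarrow> vanishes_below k (F j)) \<Longrightarrow> vanishes_below k (\<Sum>j\<in>J. F j)"
  by (simp add: vanishes_below_def fps_sum_nth)

text \<open>Both the Leibniz rule for divided powers and the commutation of an operator with divided powers
  are proved by induction with this identity: applying a derivation to the summand \<open>(i, n - i)\<close>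
  raises one index or the other, weighted by the new value of that index.\<close>
lemma weighted_antidiagonal_sum:
  fixes f :: "nat \<Rightarrow> nat \<Rightarrow> 'b::comm_ring_1"
  shows "(\<Sum>i\<le>n. of_nat (Suc i) * f (Suc i) (n - i) + of_nat (Suc (n - i)) * f i (Suc (n - i)))
    = of_nat (Suc n) * (\<Sum>i\<le>Suc n. f i (Suc n - i))"
proof -
  have "(\<Sum>i\<le>n. of_nat (Suc i) * f (Suc i) (n - i)) = (\<Sum>i\<le>Suc n. of_nat i * f i (Suc n - i))"
    by (simp add: sum.atMost_Suc_shift del: sum.atMost_Suc of_nat_Suc)
  moreover have "(\<Sum>i\<le>n. of_nat (Suc (n - i)) * f i (Suc (n - i)))
      = (\<Sum>i\<le>Suc n. of_nat (Suc n - i) * f i (Suc n - i))"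
    by (auto intro!: sum.cong simp: Suc_diff_le simp del: of_nat_Suc of_nat_diff)
  moreover have weights: "of_nat i * f i (Suc n - i) + of_nat (Suc n - i) * f i (Suc n - i)
      = of_nat (Suc n) * f i (Suc n - i)" if "i \<le> Suc n" for i
  proof -
    have "(of_nat (Suc n) :: 'b) = of_nat i + of_nat (Suc n - i)"
      using that by (metis le_add_diff_inverse of_nat_add)
    then show ?thesis by (simp only: distrib_right)
  qed
  ultimately have "(\<Sum>i\<le>n. of_nat (Suc i) * f (Suc i) (n - i) + of_nat (Suc (n - i)) * f i (Suc (n - i)))
      = (\<Sum>i\<le>Suc n. of_nat i * f i (Suc n - i) + of_nat (Suc n - i) * f i (Suc n - i))"
    by (simp only: sum.distrib)
  also have "\<dots> = (\<Sum>i\<le>Suc n. of_nat (Suc n) * f i (Suc n - i))"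
    by (intro sum.cong refl weights) simp
  finally show ?thesis by (simp only: sum_distrib_left)
qed

lemma square_sum_eq_antidiagonal_sum:
  fixes g :: "nat \<Rightarrow> nat \<Rightarrow> 'b::comm_monoid_add"
  assumes "\<And>i j. n < i + j \<Longrightarrow> g i j = 0"
  shows "(\<Sum>i\<le>n. \<Sum>j\<le>n. g i j) = (\<Sum>k\<le>n. \<Sum>i\<le>k. g i (k - i))"
proof -
  have "(\<Sum>i\<le>n. \<Sum>j\<le>n. g i j) = (\<Sum>i\<le>n. \<Sum>j\<le>n - i. g i j)"
  proof (intro sum.cong[OF refl] sum.mono_neutral_right ballI)
    fix i j assume "i \<in> {..n}" "j \<in> {..n} - {..n - i}"
    then show "g i j = 0" by (intro assms) auto
  qed auto
  also have "\<dots> = (\<Sum>(i, j)\<in>{(i, j). i + j \<le> n}. g i j)"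
    by (subst sum.Sigma) (auto intro!: sum.cong)
  also have "\<dots> = (\<Sum>k\<le>n. \<Sum>i\<le>k. g i (k - i))"
    by (rule sum.triangle_reindex_eq)
  finally show ?thesis .
qed

section \<open>Functional calculus for operators that raise the order\<close>

abbreviation real_const :: "real \<Rightarrow> 'a::{comm_ring_1,real_algebra_1} fps" where
  "real_const r \<equiv> fps_const (of_real r)"

text \<open>Commuting with \<open>t\<close> and killing the constant coefficient together make \<open>T\<close> raise the order of
  vanishing by one, so that \<open>\<Sum>\<^sub>k p\<^sub>k T\<^sup>k\<close> makes sense for every scalar power series \<open>p\<close>.\<close>
locale order_raising_operator =
  fixes T :: "'a::{comm_ring_1,real_algebra_1} fps \<Rightarrow> 'a fps"
  assumes add: "T (F + G) = T F + T G"
    and fps_X_mult: "T (fps_X * F) = fps_X * T F"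
    and real_mult: "T (real_const r * F) = real_const r * T F"
    and nth_0: "T F $ 0 = 0"
begin

lemma zero: "T 0 = 0"
  using add[of 0 0] by simp

lemma pow_add: "(T ^^ k) (F + G) = (T ^^ k) F + (T ^^ k) G"
  by (induction k) (simp_all add: add)

lemma pow_zero: "(T ^^ k) 0 = 0"
  by (induction k) (simp_all add: zero)

lemma pow_sum: "(T ^^ k) (\<Sum>j\<in>J. F j) = (\<Sum>j\<in>J. (T ^^ k) (F j))"
  by (induction J rule: infinite_finite_induct) (simp_all add: pow_zero pow_add)

lemma pow_real_mult: "(T ^^ k) (real_const r * F) = real_const r * (T ^^ k) F"
  by (induction k) (simp_all add: real_mult)

lemma pow_fps_X_power_mult: "(T ^^ k) (fps_X ^ j * F) = fps_X ^ j * (T ^^ k) F"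
proof -
  have "T (fps_X ^ j * F) = fps_X ^ j * T F" for F
    by (induction j) (simp_all add: fps_X_mult mult.assoc)
  then show ?thesis by (induction k) simp_all
qed

lemma vanishes_below_pow:
  assumes "vanishes_below j F"
  shows "vanishes_below (k + j) ((T ^^ k) F)"
proof -
  have "vanishes_below (Suc i) (T G)" if G: "vanishes_below i G" for i G
  proof -
    obtain H where "G = fps_X ^ i * H" using G vanishes_below_iff by blast
    then have "T G = fps_X ^ i * T H" using pow_fps_X_power_mult[of 1 i H] by simp
    then show ?thesis
      using vanishes_below_mult[of i "fps_X ^ i" 1 "T H"] nth_0
      by (simp add: vanishes_below_def)
  qed
  then show ?thesis using assms by (induction k) simp_all
qed

lemma pow_nth_eq_0: "n < k \<Longrightarrow> (T ^^ k) F $ n = 0"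
  using vanishes_below_pow[of 0 F k] by (simp add: vanishes_below_def)

definition act :: "real fps \<Rightarrow> 'a fps \<Rightarrow> 'a fps" where
  "act p F = Abs_fps (\<lambda>n. \<Sum>k\<le>n. of_real (p $ k) * (T ^^ k) F $ n)"

lemma act_nth: "n \<le> M \<Longrightarrow> act p F $ n = (\<Sum>k\<le>M. of_real (p $ k) * (T ^^ k) F $ n)"
  unfolding act_def fps_nth_Abs_fps
  by (intro sum.mono_neutral_left) (auto simp: pow_nth_eq_0)

text \<open>An additive operator that raises the order can only be applied to a finite part of the series
  \<open>act p F\<close>; the remainder is pushed beyond the coefficient in question.\<close>
lemma act_approx:
  "\<exists>R. vanishes_below (Suc n) R \<and> act p F = (\<Sum>k\<le>n. real_const (p $ k) * (T ^^ k) F) + R"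
proof (intro exI conjI)
  let ?R = "act p F - (\<Sum>k\<le>n. real_const (p $ k) * (T ^^ k) F)"
  show "vanishes_below (Suc n) ?R"
    by (auto simp: vanishes_below_def fps_sum_nth act_nth[of _ n])
qed simp

lemma pow_act_nth:
  assumes "n \<le> M"
  shows "(T ^^ i) (act p F) $ n = (\<Sum>k\<le>M. of_real (p $ k) * (T ^^ (i + k)) F $ n)"
proof -
  obtain R where R: "vanishes_below (Suc M) R"
    and eq: "act p F = (\<Sum>k\<le>M. real_const (p $ k) * (T ^^ k) F) + R"
    using act_approx by blast
  have "(T ^^ i) R $ n = 0"
    using vanishes_below_pow[OF R, of i] assms by (simp add: vanishes_below_def)
  then show ?thesis
    unfolding eq by (simp add: pow_add pow_sum pow_real_mult fps_sum_nth funpow_add)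
qed

lemma act_add: "act p (F + G) = act p F + act p G"
  by (rule fps_ext) (simp add: act_def pow_add algebra_simps sum.distrib)

lemma act_zero: "act p 0 = 0"
  using act_add[of p 0 0] by simp

lemma act_sum: "act p (\<Sum>j\<in>J. F j) = (\<Sum>j\<in>J. act p (F j))"
  by (induction J rule: infinite_finite_induct) (simp_all add: act_zero act_add)

lemma act_add_left: "act (p + q) F = act p F + act q F"
  by (rule fps_ext) (simp add: act_def algebra_simps sum.distrib)

lemma act_diff_left: "act (p - q) F = act p F - act q F"
  using act_add_left[of "p - q" q F] by (simp add: algebra_simps)

lemma act_one: "act 1 F = F"
  by (rule fps_ext) (simp add: act_def if_distrib if_distribR sum.delta cong: if_cong)

lemma act_fps_X: "act fps_X F = T F"
proof (rule fps_ext)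
  fix n
  have "act fps_X F $ n = (\<Sum>k\<le>Suc n. of_real (fps_X $ k) * (T ^^ k) F $ n)"
    by (rule act_nth) simp
  also have "\<dots> = (\<Sum>k\<in>{1}. of_real (fps_X $ k) * (T ^^ k) F $ n)"
    by (rule sum.mono_neutral_right) (auto simp: fps_X_nth)
  finally show "act fps_X F $ n = T F $ n" by simp
qed

text \<open>This makes \<open>p \<mapsto> p(T)\<close> a ring homomorphism: every identity between scalar series, such as
  \<open>log (exp X) = X\<close>, holds for the operator.\<close>
lemma act_mult: "act (p * q) F = act p (act q F)"
proof (rule fps_ext)
  fix n
  have "act p (act q F) $ n
      = (\<Sum>i\<le>n. \<Sum>j\<le>n. of_real (p $ i * q $ j) * (T ^^ (i + j)) F $ n)"
    by (simp add: act_nth[of n n] pow_act_nth[of n n] sum_distrib_left mult.assoc)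
  also have "\<dots> = (\<Sum>k\<le>n. \<Sum>i\<le>k. of_real (p $ i * q $ (k - i)) * (T ^^ (i + (k - i))) F $ n)"
    by (rule square_sum_eq_antidiagonal_sum) (simp add: pow_nth_eq_0)
  also have "\<dots> = act (p * q) F $ n"
    by (auto simp: act_nth[of n n] fps_mult_nth sum_distrib_right atLeast0AtMost intro!: sum.cong)
  finally show "act (p * q) F $ n = act p (act q F) $ n" ..
qed

lemma act_power: "act (p ^ n) F = (act p ^^ n) F"
  by (induction n arbitrary: F) (simp_all add: act_one act_mult)

lemma act_fps_X_mult: "act p (fps_X * F) = fps_X * act p F"
proof (rule fps_ext)
  fix n
  show "act p (fps_X * F) $ n = (fps_X * act p F) $ n"
    using pow_fps_X_power_mult[of _ 1 F]
    by (cases n) (simp_all add: act_nth[of _ n] act_nth[of _ 0])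
qed

lemma vanishes_below_act: "vanishes_below j F \<Longrightarrow> vanishes_below j (act p F)"
  using vanishes_below_mono[OF vanishes_below_pow, of j F j]
  by (auto simp: vanishes_below_def act_def intro!: sum.neutral)

text \<open>The substitution of \<open>exp X - 1\<close> into \<open>log (1 + X)\<close> is carried out on the scalar series and
  transported to \<open>T\<close>.\<close>
lemma log_exp_act:
  assumes "n \<le> M"
  shows "(\<Sum>k\<le>M. of_real (fps_ln 1 $ k) * (act (fps_exp 1 - 1) ^^ k) F $ n) = T F $ n"
proof -
  let ?e = "fps_exp 1 - 1 :: real fps"
  have "(\<Sum>k\<le>M. of_real (fps_ln 1 $ k) * (act ?e ^^ k) F $ n)
      = (\<Sum>k\<le>M. \<Sum>j\<le>M. of_real (fps_ln 1 $ k * (?e ^ k) $ j) * (T ^^ j) F $ n)"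
    by (simp add: act_nth[OF assms] sum_distrib_left mult.assoc flip: act_power)
  also have "\<dots> = (\<Sum>j\<le>M. of_real (\<Sum>k\<le>M. fps_ln 1 $ k * (?e ^ k) $ j) * (T ^^ j) F $ n)"
    by (subst sum.swap) (simp add: sum_distrib_right)
  also have "\<dots> = (\<Sum>j\<le>M. of_real ((fps_ln 1 oo ?e) $ j) * (T ^^ j) F $ n)"
  proof (intro sum.cong refl)
    fix j assume j: "j \<in> {..M}"
    have "(\<Sum>k\<le>M. fps_ln 1 $ k * (?e ^ k) $ j) = (\<Sum>k\<in>{0..j}. fps_ln 1 $ k * (?e ^ k) $ j)"
    proof (rule sum.mono_neutral_right)
      show "\<forall>k\<in>{..M} - {0..j}. fps_ln 1 $ k * (?e ^ k) $ j = 0"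
        using startsby_zero_power_prefix[of ?e] by auto
    qed (use j in auto)
    then show "of_real (\<Sum>k\<le>M. fps_ln 1 $ k * (?e ^ k) $ j) * (T ^^ j) F $ n
        = of_real ((fps_ln 1 oo ?e) $ j) * (T ^^ j) F $ n"
      by (simp add: fps_compose_nth)
  qed
  also have "fps_ln 1 oo ?e = fps_X"
    by (simp add: fps_ln_fps_exp_inv fps_inv_fps_exp_compose)
  also have "(\<Sum>j\<le>M. of_real (fps_X $ j) * (T ^^ j) F $ n) = T F $ n"
    using act_nth[OF assms, of fps_X F] by (simp add: act_fps_X)
  finally show ?thesis .
qed

lemma act_real_mult: "act p (real_const r * F) = real_const r * act p F"
  by (rule fps_ext) (simp add: act_def pow_real_mult sum_distrib_left mult.left_commute)

lemma order_raising_operator_act: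
  assumes "p $ 0 = 0"
  shows "order_raising_operator (act p)"
proof
  show "act p F $ 0 = 0" for F
    using assms by (simp add: act_nth[of 0 0])
qed (simp_all add: act_add act_fps_X_mult act_real_mult)

end

section \<open>Graded operators and compositions\<close>

text \<open>The operator \<open>\<Sum>\<^sub>i t\<^sup>i P\<^sub>i\<close> (over \<open>i \<ge> 1\<close>) on power series. Its powers are sums over compositions,
  which is how both sums over compositions in the theorem arise.\<close>

definition graded :: "(nat \<Rightarrow> 'a::comm_monoid_add \<Rightarrow> 'a) \<Rightarrow> 'a fps \<Rightarrow> 'a fps" where
  "graded P F = Abs_fps (\<lambda>n. \<Sum>i=1..n. P i (F $ (n - i)))"

lemma graded_nth: "graded P F $ n = (\<Sum>i=1..n. P i (F $ (n - i)))"
  by (simp add: graded_def)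

lemma compositions_0: "compositions 0 n = (if n = 0 then {[]} else {})"
  by (auto simp: compositions_def)

lemma compositions_Suc:
  "compositions (Suc k) n = (\<lambda>(i, is). i # is) ` Sigma {1..n} (\<lambda>i. compositions k (n - i))"
  by (auto simp: compositions_def image_iff length_Suc_conv)

lemma sum_compositions_Suc:
  "(\<Sum>is\<in>compositions (Suc k) n. h is) = (\<Sum>i=1..n. \<Sum>is\<in>compositions k (n - i). h (i # is))"
  unfolding compositions_Suc
  by (subst sum.reindex) (auto simp: inj_on_def sum.Sigma finite_compositions intro!: sum.cong)

lemma compositions_eq_empty: "n < k \<Longrightarrow> compositions k n = {}"
proof -
  have "length w \<le> sum_list w" if "\<forall>i\<in>set w. 1 \<le> i" for w :: "nat list"
    using that by (induction w) auto
  then show "compositions k n = {}" if "n < k"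
    using that by (force simp: compositions_def)
qed

lemma graded_pow_const:
  fixes P :: "nat \<Rightarrow> 'a::ab_group_add \<Rightarrow> 'a"
  assumes add: "\<And>i a b. P i (a + b) = P i a + P i b"
  shows "(graded P ^^ k) (fps_const a) $ n = (\<Sum>is\<in>compositions k n. foldr P is a)"
proof (induction k arbitrary: n)
  case 0
  show ?case by (simp add: compositions_0)
next
  case (Suc k)
  have "P i 0 = 0" for i using add[of i 0 0] by simp
  then have "P i (\<Sum>x\<in>X. h x) = (\<Sum>x\<in>X. P i (h x))" for i X and h :: "nat list \<Rightarrow> 'a"
    by (induction X rule: infinite_finite_induct) (simp_all add: add)
  then show ?case
    by (simp add: graded_nth Suc.IH sum_compositions_Suc)
qed

text \<open>An operator that commutes with \<open>t\<close> is determined by its values on constant series, so an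
  identity that is known on constants extends to powers of the operator.\<close>
lemma (in order_raising_operator) eq_graded: "T = graded (\<lambda>i a. T (fps_const a) $ i)"
proof (intro ext fps_ext)
  fix F n
  show "T F $ n = graded (\<lambda>i a. T (fps_const a) $ i) F $ n"
  proof (induction n arbitrary: F)
    case 0
    show ?case by (simp add: nth_0 graded_nth)
  next
    case (Suc n)
    have "F = fps_const (F $ 0) + fps_X * fps_shift 1 F"
      by (rule fps_ext) simp
    then have "T F = T (fps_const (F $ 0)) + fps_X * T (fps_shift 1 F)"
      by (metis add fps_X_mult)
    then have "T F $ Suc n = T (fps_const (F $ 0)) $ Suc n + T (fps_shift 1 F) $ n"
      by simp
    also have "\<dots> = graded (\<lambda>i a. T (fps_const a) $ i) F $ Suc n"
      by (auto simp: Suc.IH graded_nth Suc_diff_le intro!: sum.cong)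
    finally show ?case .
  qed
qed

section \<open>Derivations of an algebra with coordinates\<close>

text \<open>The model is an algebra of functions with its partial derivatives and coordinate functions \<open>x j\<close>.
  The coordinates serve to read off the components of a vector field from its action.\<close>
locale commuting_derivations =
  fixes D :: "'j::finite \<Rightarrow> 'a::{comm_ring_1,real_algebra_1} \<Rightarrow> 'a"
    and x :: "'j \<Rightarrow> 'a"
  assumes D_add: "D j (a + b) = D j a + D j b"
    and D_mult: "D j (a * b) = D j a * b + a * D j b"
    and D_of_real: "D j (of_real r) = 0"
    and D_commute: "D j (D k a) = D k (D j a)"
    and D_coordinate: "D k (x j) = (if k = j then 1 else 0)"
begin

lemma D_zero: "D j 0 = 0" and D_one: "D j 1 = 0"
  using D_of_real[of j 0] D_of_real[of j 1] by simp_all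

lemma D_sum: "D j (\<Sum>i\<in>I. f i) = (\<Sum>i\<in>I. D j (f i))"
  by (induction I rule: infinite_finite_induct) (simp_all add: D_zero D_add)

lemma D_of_real_mult: "D j (of_real r * a) = of_real r * D j a"
  by (simp add: D_mult D_of_real)

lemma D_of_nat_mult: "D j (of_nat n * a) = of_nat n * D j a"
  using D_of_real_mult[of j "real n" a] by simp

definition along :: "('j \<Rightarrow> 'a) \<Rightarrow> 'a \<Rightarrow> 'a" where
  "along u a = (\<Sum>j\<in>UNIV. u j * D j a)"

definition taylor :: "('j \<Rightarrow> 'a) \<Rightarrow> nat \<Rightarrow> 'a \<Rightarrow> 'a" where
  "taylor v n a = of_real (1 / fact n) * (\<Sum>js | length js = n. (\<Prod>j\<leftarrow>js. v j) * foldr D js a)"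

lemma along_add: "along u (a + b) = along u a + along u b"
  by (simp add: along_def D_add algebra_simps sum.distrib)

lemma taylor_add: "taylor v n (a + b) = taylor v n a + taylor v n b"
proof -
  have "foldr D js (a + b) = foldr D js a + foldr D js b" for js
    by (induction js) (simp_all add: D_add)
  then show ?thesis by (simp add: taylor_def algebra_simps sum.distrib)
qed

lemma taylor_0: "taylor v 0 a = a"
  by (simp add: taylor_def)

text \<open>Splitting off the innermost derivative gives the recursion that determines the Taylor
  coefficients.\<close>
lemma taylor_Suc: "of_nat (Suc n) * taylor v (Suc n) a = (\<Sum>j\<in>UNIV. v j * taylor v n (D j a))"
proof -
  have lists: "{js :: 'j list. length js = Suc n}
      = (\<lambda>(j, js). js @ [j]) ` (UNIV \<times> {js. length js = n})"
  proof (intro set_eqI iffI)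
    fix js :: "'j list" assume "js \<in> {js. length js = Suc n}"
    then show "js \<in> (\<lambda>(j, js). js @ [j]) ` (UNIV \<times> {js. length js = n})"
      by (cases js rule: rev_cases) (auto simp: image_iff)
  qed auto
  have "(of_nat (Suc n) :: 'a) * of_real (1 / fact (Suc n)) = of_real (real (Suc n) * (1 / fact (Suc n)))"
    by (simp only: of_real_mult of_real_of_nat_eq)
  also have "\<dots> = of_real (1 / fact n)"
    by (simp add: field_simps del: of_nat_Suc)
  finally have fact: "(of_nat (Suc n) :: 'a) * of_real (1 / fact (Suc n)) = of_real (1 / fact n)" .
  have "of_nat (Suc n) * taylor v (Suc n) a
      = of_real (1 / fact n) * (\<Sum>js | length js = Suc n. (\<Prod>j\<leftarrow>js. v j) * foldr D js a)"
    unfolding taylor_def by (simp only: fact flip: mult.assoc)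
  also have "\<dots> = of_real (1 / fact n) *
      (\<Sum>(j, js)\<in>UNIV \<times> {js. length js = n}. v j * ((\<Prod>j\<leftarrow>js. v j) * foldr D js (D j a)))"
    unfolding lists by (subst sum.reindex) (auto simp: inj_on_def case_prod_beta mult_ac intro!: sum.cong)
  also have "\<dots> = (\<Sum>j\<in>UNIV. v j * taylor v n (D j a))"
    by (simp add: taylor_def sum_distrib_left mult_ac flip: sum.cartesian_product)
  finally show ?thesis .
qed

definition lift_D :: "'j \<Rightarrow> 'a fps \<Rightarrow> 'a fps" where
  "lift_D j F = Abs_fps (\<lambda>n. D j (F $ n))"

definition lift_along :: "('j \<Rightarrow> 'a fps) \<Rightarrow> 'a fps \<Rightarrow> 'a fps" where
  "lift_along u F = (\<Sum>j\<in>UNIV. u j * lift_D j F)"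

text \<open>The derivation \<open>t d/dt\<close>, which unlike \<open>d/dt\<close> preserves the order of vanishing.\<close>
definition euler :: "'a fps \<Rightarrow> 'a fps" where
  "euler F = Abs_fps (\<lambda>n. of_nat n * F $ n)"

lemma lift_D_nth [simp]: "lift_D j F $ n = D j (F $ n)"
  by (simp add: lift_D_def)

lemma euler_nth [simp]: "euler F $ n = of_nat n * F $ n"
  by (simp add: euler_def)

lemma lift_D_add: "lift_D j (F + G) = lift_D j F + lift_D j G"
  by (rule fps_ext) (simp add: D_add)

lemma lift_D_const: "lift_D j (fps_const a) = fps_const (D j a)"
  by (rule fps_ext) (simp add: D_zero)

lemma lift_D_sum: "lift_D j (\<Sum>i\<in>I. F i) = (\<Sum>i\<in>I. lift_D j (F i))"
  by (rule fps_ext) (simp add: fps_sum_nth D_sum)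

lemma lift_D_mult: "lift_D j (F * G) = lift_D j F * G + F * lift_D j G"
  by (rule fps_ext) (simp add: fps_mult_nth D_sum D_mult sum.distrib)

lemma lift_D_commute: "lift_D j (lift_D k F) = lift_D k (lift_D j F)"
  by (rule fps_ext) (simp add: D_commute)

lemma lift_D_fps_X: "lift_D j fps_X = 0"
  by (rule fps_ext) (simp add: fps_X_nth D_zero D_one)

lemma lift_D_real: "lift_D j (real_const r) = 0"
  by (simp add: lift_D_const D_of_real)

lemma vanishes_below_lift_D: "vanishes_below k F \<Longrightarrow> vanishes_below k (lift_D j F)"
  by (simp add: vanishes_below_def D_zero)

lemma euler_eq: "euler F = fps_X * fps_deriv F"
proof (rule fps_ext)
  show "euler F $ n = (fps_X * fps_deriv F) $ n" for n by (cases n) simp_all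
qed

lemma euler_mult: "euler (F * G) = euler F * G + F * euler G"
  by (simp add: euler_eq algebra_simps)

lemma euler_sum: "euler (\<Sum>i\<in>I. F i) = (\<Sum>i\<in>I. euler (F i))"
  by (simp add: euler_eq fps_deriv_sum sum_distrib_left)

lemma euler_const: "euler (fps_const a) = 0"
  by (simp add: euler_eq)

lemma euler_lift_D: "euler (lift_D j F) = lift_D j (euler F)"
  by (rule fps_ext) (simp add: D_of_nat_mult)

lemma lift_along_add: "lift_along u (F + G) = lift_along u F + lift_along u G"
  by (simp add: lift_along_def lift_D_add algebra_simps sum.distrib)

lemma lift_along_mult: "lift_along u (F * G) = lift_along u F * G + F * lift_along u G"
  by (simp add: lift_along_def lift_D_mult algebra_simps sum.distrib sum_distrib_left)

lemma lift_along_real_mult: "lift_along u (real_const r * F) = real_const r * lift_along u F"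
  unfolding lift_along_mult by (simp add: lift_along_def lift_D_real)

lemma lift_along_fps_X_mult: "lift_along u (fps_X * F) = fps_X * lift_along u F"
  unfolding lift_along_mult by (simp add: lift_along_def lift_D_fps_X)

lemma lift_along_scale: "lift_along (\<lambda>j. G * u j) F = G * lift_along u F"
  by (simp add: lift_along_def sum_distrib_left mult.assoc)

lemma euler_lift_along: "euler (lift_along u F) = lift_along u (euler F) + lift_along (\<lambda>j. euler (u j)) F"
  by (simp add: lift_along_def euler_sum euler_mult euler_lift_D sum.distrib)

text \<open>The second-order parts of the two compositions agree because the derivations commute, so the
  commutator of two vector fields is a vector field.\<close>
lemma lift_along_commutator:
  "lift_along u (lift_along w F)
    = lift_along w (lift_along u F) + lift_along (\<lambda>j. lift_along u (w j) - lift_along w (u j)) F"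
proof -
  have expand: "lift_along u (lift_along w F) = lift_along (\<lambda>j. lift_along u (w j)) F
      + (\<Sum>k\<in>UNIV. \<Sum>j\<in>UNIV. u k * w j * lift_D k (lift_D j F))" for u w
  proof -
    have "lift_along u (lift_along w F)
        = (\<Sum>k\<in>UNIV. \<Sum>j\<in>UNIV. u k * lift_D k (w j) * lift_D j F)
          + (\<Sum>k\<in>UNIV. \<Sum>j\<in>UNIV. u k * w j * lift_D k (lift_D j F))"
      by (simp add: lift_along_def lift_D_sum lift_D_mult sum_distrib_left distrib_left sum.distrib mult.assoc)
    moreover have "(\<Sum>k\<in>UNIV. \<Sum>j\<in>UNIV. u k * lift_D k (w j) * lift_D j F)
        = lift_along (\<lambda>j. lift_along u (w j)) F"
      by (subst sum.swap) (simp add: lift_along_def sum_distrib_right)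
    ultimately show ?thesis by simp
  qed
  have "(\<Sum>k\<in>UNIV. \<Sum>j\<in>UNIV. u k * w j * lift_D k (lift_D j F))
      = (\<Sum>k\<in>UNIV. \<Sum>j\<in>UNIV. w k * u j * lift_D k (lift_D j F))"
    by (subst sum.swap) (simp add: lift_D_commute mult.commute)
  then show ?thesis
    by (simp add: expand[of u w] expand[of w u])
       (simp add: lift_along_def left_diff_distrib sum_subtractf)
qed

end

section \<open>The flow of a formal vector field\<close>

text \<open>A field without constant coefficient raises the order of vanishing, so its exponential, the flow at
  time one, is a formal power series in \<open>t\<close>.\<close>
locale formal_vector_field = commuting_derivations D x
  for D :: "'j::finite \<Rightarrow> 'a::{comm_ring_1,real_algebra_1} \<Rightarrow> 'a" and x +
  fixes \<omega> :: "'j \<Rightarrow> 'a fps"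
  assumes \<omega>_nth_0: "\<omega> j $ 0 = 0"
begin

sublocale order_raising_operator "lift_along \<omega>"
proof
  show "lift_along \<omega> F $ 0 = 0" for F
    by (simp add: lift_along_def fps_sum_nth \<omega>_nth_0)
qed (simp_all add: lift_along_add lift_along_fps_X_mult lift_along_real_mult)

abbreviation T :: "'a fps \<Rightarrow> 'a fps" where "T \<equiv> lift_along \<omega>"

definition flow :: "'a fps \<Rightarrow> 'a fps" where
  "flow = act (fps_exp 1)"

definition divided_power :: "nat \<Rightarrow> 'a fps \<Rightarrow> 'a fps" where
  "divided_power n F = real_const (1 / fact n) * (T ^^ n) F"

lemma flow_nth: "n \<le> M \<Longrightarrow> flow F $ n = (\<Sum>k\<le>M. divided_power k F $ n)"
  by (simp add: flow_def divided_power_def act_nth)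

text \<open>The series ring may have zero divisors, but positive integers are invertible in it.\<close>
lemma of_nat_Suc_cancel:
  fixes F G :: "'a fps"
  assumes "of_nat (Suc n) * F = of_nat (Suc n) * G"
  shows "F = G"
proof -
  have inv: "real_const (1 / real (Suc n)) * of_nat (Suc n) = (1 :: 'a fps)"
  proof -
    have "real_const (1 / real (Suc n)) * of_nat (Suc n) = (real_const (1 / real (Suc n) * real (Suc n)) :: 'a fps)"
      by (simp only: of_real_mult of_real_of_nat_eq fps_const_mult flip: fps_of_nat)
    then show ?thesis by (simp del: of_nat_Suc)
  qed
  show ?thesis
    using arg_cong[OF assms, of "(*) (real_const (1 / real (Suc n)))"]
    by (simp only: inv mult_1_left flip: mult.assoc)
qed

lemma divided_power_0: "divided_power 0 F = F"
  by (simp add: divided_power_def)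

lemma divided_power_Suc: "of_nat (Suc n) * divided_power (Suc n) F = T (divided_power n F)"
proof -
  have "of_nat (Suc n) * real_const (1 / fact (Suc n)) = (real_const (real (Suc n) * (1 / fact (Suc n))) :: 'a fps)"
    by (simp only: of_real_mult of_real_of_nat_eq fps_const_mult flip: fps_of_nat)
  also have "\<dots> = real_const (1 / fact n)"
    by (simp add: field_simps del: of_nat_Suc)
  finally have "of_nat (Suc n) * real_const (1 / fact (Suc n)) = (real_const (1 / fact n) :: 'a fps)" .
  then show ?thesis
    by (simp only: divided_power_def real_mult funpow.simps o_apply flip: mult.assoc)
qed

lemma divided_power_T: "divided_power n (T F) = T (divided_power n F)"
  by (simp add: divided_power_def real_mult funpow_swap1)

lemma divided_power_add: "divided_power n (F + G) = divided_power n F + divided_power n G"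
  by (simp add: divided_power_def pow_add algebra_simps)

lemma vanishes_below_divided_power:
  "vanishes_below j F \<Longrightarrow> vanishes_below (k + j) (divided_power k F)"
  using vanishes_below_pow[of j F k] by (simp add: divided_power_def vanishes_below_def)

lemma divided_power_nth_eq_0: "n < k \<Longrightarrow> divided_power k F $ n = 0"
  by (simp add: divided_power_def pow_nth_eq_0)

lemma sum_T: "T (\<Sum>i\<in>I. F i) = (\<Sum>i\<in>I. T (F i))"
  using pow_sum[of 1 F I] by simp

lemma divided_power_mult:
  "divided_power n (F * G) = (\<Sum>i\<le>n. divided_power i F * divided_power (n - i) G)"
proof (induction n)
  case 0
  show ?case by (simp add: divided_power_0)
next
  case (Suc n)
  have "of_nat (Suc n) * divided_power (Suc n) (F * G)
      = (\<Sum>i\<le>n. T (divided_power i F * divided_power (n - i) G))"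
    by (simp only: divided_power_Suc Suc.IH sum_T)
  also have "\<dots> = (\<Sum>i\<le>n. of_nat (Suc i) * (divided_power (Suc i) F * divided_power (n - i) G)
      + of_nat (Suc (n - i)) * (divided_power i F * divided_power (Suc (n - i)) G))"
    by (intro sum.cong refl)
       (simp only: lift_along_mult flip: divided_power_Suc, simp only: mult_ac)
  also have "\<dots> = of_nat (Suc n) * (\<Sum>i\<le>Suc n. divided_power i F * divided_power (Suc n - i) G)"
    by (rule weighted_antidiagonal_sum)
  finally show ?case by (rule of_nat_Suc_cancel)
qed

text \<open>The exponential of a derivation is multiplicative, by the Leibniz rule for divided powers. Modulo
  \<open>t\<^sup>n\<^sup>+\<^sup>1\<close> both factors are finite sums of divided powers, and the products of total degree above \<open>n\<close>
  vanish to order \<open>n + 1\<close>.\<close>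
lemma flow_mult: "flow (F * G) = flow F * flow G"
proof (rule fps_ext)
  fix n
  let ?S = "\<lambda>F. \<Sum>k\<le>n. divided_power k F"
  have agree: "flow F $ i = ?S F $ i" if "i \<le> n" for F i
    using flow_nth[OF that] by (simp add: fps_sum_nth)
  have "(flow F * flow G) $ n = (?S F * ?S G) $ n"
    by (simp add: fps_mult_nth agree)
  also have "\<dots> = (\<Sum>i\<le>n. \<Sum>j\<le>n. (divided_power i F * divided_power j G) $ n)"
    by (simp add: sum_product fps_sum_nth)
  also have "\<dots> = (\<Sum>k\<le>n. \<Sum>i\<le>k. (divided_power i F * divided_power (k - i) G) $ n)"
  proof (rule square_sum_eq_antidiagonal_sum)
    fix i j assume "n < i + j"
    moreover have "vanishes_below (i + j) (divided_power i F * divided_power j G)"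
      by (intro vanishes_below_mult) (simp_all add: vanishes_below_def divided_power_nth_eq_0)
    ultimately show "(divided_power i F * divided_power j G) $ n = 0"
      by (simp add: vanishes_below_def)
  qed
  also have "\<dots> = flow (F * G) $ n"
    by (simp add: flow_nth[of n n] divided_power_mult fps_sum_nth)
  finally show "flow (F * G) $ n = (flow F * flow G) $ n" ..
qed

lemma flow_sum: "flow (\<Sum>i\<in>I. F i) = (\<Sum>i\<in>I. flow (F i))"
  by (simp add: flow_def act_sum)

lemma flow_one: "flow 1 = 1"
proof -
  have "T 1 = 0"
    by (simp add: lift_along_def lift_D_const D_one flip: fps_const_1_eq_1)
  then have pow: "(T ^^ k) 1 = (if k = 0 then 1 else 0)" for k
    using pow_zero by (cases k) (simp_all add: funpow_swap1)
  show ?thesis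
  proof (rule fps_ext)
    fix n
    have "flow 1 $ n = (\<Sum>k\<in>{0}. of_real (fps_exp 1 $ k) * (T ^^ k) 1 $ n)"
      unfolding flow_def act_def fps_nth_Abs_fps
      by (rule sum.mono_neutral_right) (auto simp: pow simp del: funpow.simps)
    then show "flow 1 $ n = 1 $ n" by simp
  qed
qed

text \<open>The operators \<open>(- ad \<omega>)\<^sup>c \<delta> / c!\<close> with \<open>\<delta>\<close> the Euler operator: their sum is
  \<open>exp (- \<omega>) \<delta> exp \<omega>\<close>. For \<open>c = 0\<close> this is \<open>\<delta>\<close> itself; from \<open>c = 1\<close> on it is a vector field, whose
  components are \<open>conjugate_field (c - 1)\<close>. This index shift is why the factor \<open>1 / (c + 2)\<close> appears
  below.\<close>
primrec conjugate_field :: "nat \<Rightarrow> 'j \<Rightarrow> 'a fps" where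
  "conjugate_field 0 = (\<lambda>j. euler (\<omega> j))"
| "conjugate_field (Suc c) = (\<lambda>j. real_const (1 / real (c + 2)) *
      (lift_along (conjugate_field c) (\<omega> j) - T (conjugate_field c j)))"

definition conjugate_op :: "nat \<Rightarrow> 'a fps \<Rightarrow> 'a fps" where
  "conjugate_op c = (case c of 0 \<Rightarrow> euler | Suc b \<Rightarrow> lift_along (conjugate_field b))"

lemma conjugate_op_T:
  "conjugate_op c (T F) = T (conjugate_op c F) + of_nat (Suc c) * conjugate_op (Suc c) F"
proof (cases c)
  case 0
  then show ?thesis by (simp add: conjugate_op_def euler_lift_along)
next
  case (Suc b)
  have "of_nat (Suc c) * real_const (1 / real (b + 2)) = (real_const (real (Suc c) * (1 / real (b + 2))) :: 'a fps)"
    by (simp only: of_real_mult of_real_of_nat_eq fps_const_mult flip: fps_of_nat)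
  also have "\<dots> = 1" using Suc by (simp add: field_simps)
  finally have "of_nat (Suc c) * real_const (1 / real (b + 2)) = (1 :: 'a fps)" .
  then have "of_nat (Suc c) * conjugate_op (Suc c) F
      = lift_along (\<lambda>j. lift_along (conjugate_field b) (\<omega> j) - T (conjugate_field b j)) F"
    using Suc by (simp add: conjugate_op_def lift_along_scale del: of_nat_Suc of_nat_add flip: mult.assoc)
  then show ?thesis
    using lift_along_commutator[of "conjugate_field b" \<omega> F] Suc
    by (simp add: conjugate_op_def del: of_nat_Suc)
qed

text \<open>The part of degree \<open>n\<close> in \<open>\<omega>\<close> of the identity \<open>\<delta> exp \<omega> = exp \<omega> (exp (- \<omega>) \<delta> exp \<omega>)\<close>.\<close>
lemma conjugate_op_divided_power:
  "euler (divided_power n F) = (\<Sum>c\<le>n. divided_power (n - c) (conjugate_op c F))"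
proof (induction n arbitrary: F)
  case 0
  show ?case by (simp add: divided_power_0 conjugate_op_def)
next
  case (Suc n)
  have scale: "euler (of_nat (Suc n) * F) = of_nat (Suc n) * euler F" for F :: "'a fps"
    by (simp only: euler_mult euler_const flip: fps_of_nat) simp
  have "of_nat (Suc n) * euler (divided_power (Suc n) F) = euler (divided_power n (T F))"
    by (simp only: divided_power_T divided_power_Suc flip: scale)
  also have "\<dots> = (\<Sum>c\<le>n. divided_power (n - c) (T (conjugate_op c F) + of_nat (Suc c) * conjugate_op (Suc c) F))"
    by (simp only: Suc.IH conjugate_op_T)
  also have "\<dots> = (\<Sum>c\<le>n. of_nat (Suc c) * divided_power (n - c) (conjugate_op (Suc c) F)
      + of_nat (Suc (n - c)) * divided_power (Suc (n - c)) (conjugate_op c F))"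
  proof (intro sum.cong refl)
    have of_nat: "of_nat c = (real_const (real c) :: 'a fps)" for c
      by (simp add: fps_of_nat)
    have "divided_power k (of_nat c * F) = of_nat c * divided_power k F" for k c F
      unfolding of_nat divided_power_def pow_real_mult by (rule mult.left_commute)
    then show "divided_power (n - c) (T (conjugate_op c F) + of_nat (Suc c) * conjugate_op (Suc c) F)
      = of_nat (Suc c) * divided_power (n - c) (conjugate_op (Suc c) F)
      + of_nat (Suc (n - c)) * divided_power (Suc (n - c)) (conjugate_op c F)" for c
      by (simp only: divided_power_add divided_power_T divided_power_Suc add.commute)
  qed
  also have "\<dots> = of_nat (Suc n) * (\<Sum>c\<le>Suc n. divided_power (Suc n - c) (conjugate_op c F))"
    using weighted_antidiagonal_sum[of "\<lambda>c k. divided_power k (conjugate_op c F)" n] by simp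
  finally show ?case by (rule of_nat_Suc_cancel)
qed

lemma vanishes_below_lift_along:
  assumes "\<And>j. vanishes_below k (u j)" "vanishes_below l F"
  shows "vanishes_below (k + l) (lift_along u F)"
  unfolding lift_along_def
  by (intro vanishes_below_sum vanishes_below_mult vanishes_below_lift_D assms)

text \<open>Each commutator with \<open>\<omega>\<close> raises the order, so a coefficient of the conjugated operator involves
  only finitely many of these fields.\<close>
lemma vanishes_below_conjugate_field: "vanishes_below (Suc c) (conjugate_field c j)"
proof (induction c arbitrary: j)
  case 0
  show ?case by (simp add: vanishes_below_def)
next
  case (Suc c)
  have \<omega>: "vanishes_below 1 (\<omega> j)" for j by (simp add: vanishes_below_def \<omega>_nth_0)
  have "vanishes_below (Suc c + 1) (lift_along (conjugate_field c) (\<omega> j))"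
    by (rule vanishes_below_lift_along[OF Suc.IH \<omega>])
  moreover have "vanishes_below (1 + Suc c) (T (conjugate_field c j))"
    by (rule vanishes_below_lift_along[OF \<omega> Suc.IH])
  ultimately show ?case by (simp add: vanishes_below_def)
qed

text \<open>The differential equation \<open>\<delta> (exp \<omega> F) = \<Sum>\<^sub>j (exp \<omega> \<Psi>\<^sub>j) (exp \<omega> (\<partial>\<^sub>j F))\<close> for \<open>F\<close> constant in \<open>t\<close>,
  where \<open>\<Psi>\<close> is the sum of the fields \<open>conjugate_field c\<close>; those with \<open>c \<ge> n\<close> do not reach the
  coefficient of \<open>t\<^sup>n\<close>.\<close>
lemma euler_flow_nth:
  assumes "euler F = 0"
  shows "(euler (flow F)) $ n
    = (\<Sum>j\<in>UNIV. ((\<Sum>c<n. flow (conjugate_field c j)) * flow (lift_D j F)) $ n)"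
proof -
  \<comment> \<open>the contribution of \<open>\<omega>\<^sup>i / i!\<close> applied to the field number \<open>c\<close>, of order at least \<open>i + c + 1\<close>\<close>
  let ?g = "\<lambda>i c. divided_power i (lift_along (conjugate_field c) F) $ n"
  have g0: "?g i c = 0" if "n \<le> i + c" for i c
    using vanishes_below_divided_power[OF vanishes_below_lift_along[OF vanishes_below_conjugate_field, of 0 F c], of i] that
    by (simp add: vanishes_below_def)
  have "(euler (flow F)) $ n = (\<Sum>k\<le>n. euler (divided_power k F) $ n)"
    by (simp add: flow_nth[of n n] sum_distrib_left)
  also have "\<dots> = (\<Sum>k\<le>n. \<Sum>c<k. ?g (k - Suc c) c)"
  proof (intro sum.cong refl)
    fix k
    have "divided_power k 0 = 0" using divided_power_add[of k 0 0] by simp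
    then show "euler (divided_power k F) $ n = (\<Sum>c<k. ?g (k - Suc c) c)"
      using assms
      by (simp add: conjugate_op_divided_power fps_sum_nth sum.atMost_shift conjugate_op_def)
  qed
  also have "\<dots> = (\<Sum>k<n. \<Sum>c\<le>k. ?g (k - c) c)"
    by (simp add: sum.atMost_shift lessThan_Suc_atMost)
  also have "\<dots> = (\<Sum>c<n. flow (lift_along (conjugate_field c) F) $ n)"
  proof (cases n)
    case (Suc m)
    have "(\<Sum>k\<le>m. \<Sum>c\<le>k. ?g (k - c) c) = (\<Sum>c\<le>m. \<Sum>i\<le>m. ?g i c)"
      by (rule square_sum_eq_antidiagonal_sum[symmetric]) (use g0 Suc in auto)
    also have "\<dots> = (\<Sum>c\<le>m. \<Sum>i\<le>n. ?g i c)"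
      using Suc g0 by simp
    finally show ?thesis
      by (simp only: flow_nth[of n n, OF order_refl]) (simp only: Suc lessThan_Suc_atMost)
  qed simp
  also have "\<dots> = (\<Sum>c<n. \<Sum>j\<in>UNIV. (flow (conjugate_field c j) * flow (lift_D j F)) $ n)"
    by (simp add: lift_along_def flow_sum flow_mult fps_sum_nth)
  also have "\<dots> = (\<Sum>j\<in>UNIV. ((\<Sum>c<n. flow (conjugate_field c j)) * flow (lift_D j F)) $ n)"
    by (subst sum.swap) (simp add: sum_distrib_right fps_sum_nth)
  finally show ?thesis .
qed

text \<open>A flow that translates the coordinates by \<open>t v\<close> is the substitution \<open>a \<mapsto> a (x + t v)\<close>. The field
  \<open>exp \<omega> \<Psi>\<close> of the differential equation does not depend on the function, so evaluating the equation
  at the coordinates determines it as \<open>t v\<close>; for other functions the equation is then the recursion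
  \<open>taylor_Suc\<close>.\<close>
lemma flow_const_eq_taylor:
  assumes coord: "\<And>j. flow (fps_const (x j)) = fps_const (x j) + fps_X * fps_const (v j)"
  shows "flow (fps_const a) $ n = taylor v n a"
proof (induction n arbitrary: a)
  case 0
  show ?case by (simp add: flow_nth[of 0 0] divided_power_0 taylor_0)
next
  case (Suc n)
  have field: "(\<Sum>c<m. flow (conjugate_field c j)) $ k = (fps_X * fps_const (v j)) $ k" if "k \<le> m" for m k j
  proof -
    have "flow (conjugate_field c j) $ k = 0" if "k \<le> c" for c
      using vanishes_below_act[OF vanishes_below_conjugate_field[of c j], of "fps_exp 1"] that
      by (simp add: flow_def vanishes_below_def)
    then have "(\<Sum>c<m. flow (conjugate_field c j)) $ k = (\<Sum>c<k. flow (conjugate_field c j)) $ k"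
      using that unfolding fps_sum_nth by (intro sum.mono_neutral_right) auto
    also have "\<dots> = (\<Sum>i\<in>UNIV. ((\<Sum>c<k. flow (conjugate_field c i)) * (if i = j then 1 else 0)) $ k)"
      by (subst sum.remove[of _ j]) (auto intro!: sum.neutral)
    also have "\<dots> = (\<Sum>i\<in>UNIV. ((\<Sum>c<k. flow (conjugate_field c i)) * flow (lift_D i (fps_const (x j)))) $ k)"
      by (intro sum.cong refl)
         (auto simp: lift_D_const D_coordinate flow_one, simp add: flow_def act_zero)
    also have "\<dots> = euler (flow (fps_const (x j))) $ k"
      by (rule euler_flow_nth[symmetric]) (rule euler_const)
    also have "\<dots> = (fps_X * fps_const (v j)) $ k"
      by (cases k) (auto simp: coord fps_nth_fps_const)
    finally show ?thesis .
  qed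
  have "of_nat (Suc n) * flow (fps_const a) $ Suc n = euler (flow (fps_const a)) $ Suc n"
    by simp
  also have "\<dots> = (\<Sum>j\<in>UNIV. ((\<Sum>c<Suc n. flow (conjugate_field c j)) * flow (fps_const (D j a))) $ Suc n)"
    by (simp only: euler_flow_nth[OF euler_const] lift_D_const)
  also have "\<dots> = (\<Sum>j\<in>UNIV. (fps_X * fps_const (v j) * flow (fps_const (D j a))) $ Suc n)"
    by (intro sum.cong refl) (simp add: fps_mult_nth[of "\<Sum>c<_. _ c"] fps_mult_nth[of "fps_X * _"] field del: sum.lessThan_Suc)
  also have "\<dots> = (\<Sum>j\<in>UNIV. v j * flow (fps_const (D j a)) $ n)"
    by (simp add: mult.assoc)
  also have "\<dots> = of_nat (Suc n) * taylor v (Suc n) a"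
    by (simp only: Suc.IH taylor_Suc)
  finally have "(of_nat (Suc n) :: 'a fps) * fps_const (flow (fps_const a) $ Suc n)
      = of_nat (Suc n) * fps_const (taylor v (Suc n) a)"
    by (simp only: fps_const_mult flip: fps_of_nat)
  then have "fps_const (flow (fps_const a) $ Suc n) = fps_const (taylor v (Suc n) a)"
    by (rule of_nat_Suc_cancel)
  then show ?case by simp
qed

text \<open>The logarithm of the previous identity: \<open>exp \<omega> - 1\<close> is the graded operator of the Taylor
  coefficients, and its powers expand into compositions.\<close>
lemma log_taylor:
  assumes coord: "\<And>j. flow (fps_const (x j)) = fps_const (x j) + fps_X * fps_const (v j)"
  shows "(\<Sum>k=1..n. of_real ((- 1) ^ (k - 1) / real k) * (\<Sum>is\<in>compositions k n. foldr (taylor v) is a))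
    = along (\<lambda>j. \<omega> j $ n) a"
proof -
  let ?e = "fps_exp 1 - 1 :: real fps"
  interpret e: order_raising_operator "act ?e"
    by (rule order_raising_operator_act) simp
  have "act ?e (fps_const b) $ i = taylor v i b" if "1 \<le> i" for b i
    using that flow_const_eq_taylor[OF coord, of b i]
    by (simp add: act_diff_left act_one flow_def)
  then have graded: "act ?e = graded (taylor v)"
    by (subst e.eq_graded) (auto simp: graded_def fun_eq_iff intro!: sum.cong)
  have "along (\<lambda>j. \<omega> j $ n) a = T (fps_const a) $ n"
    by (simp add: lift_along_def along_def fps_sum_nth lift_D_const)
  also have "\<dots> = (\<Sum>k\<le>n. of_real (fps_ln 1 $ k) * (act ?e ^^ k) (fps_const a) $ n)"
    by (simp add: log_exp_act)
  also have "\<dots> = (\<Sum>k=1..n. of_real (fps_ln 1 $ k) * (act ?e ^^ k) (fps_const a) $ n)"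
    by (rule sum.mono_neutral_right) (auto simp: not_less_eq_eq)
  also have "\<dots> = (\<Sum>k=1..n. of_real ((- 1) ^ (k - 1) / real k) * (\<Sum>is\<in>compositions k n. foldr (taylor v) is a))"
    unfolding graded by (intro sum.cong refl) (simp add: fps_ln_nth graded_pow_const taylor_add)
  finally show ?thesis ..
qed

end

section \<open>The Magnus recursion\<close>

definition bernoulli_fps :: "real fps" where
  "bernoulli_fps = Abs_fps (\<lambda>k. bernoulli k / fact k)"

lemma bernoulli_sum: "(\<Sum>k\<le>n. real (Suc n choose k) * bernoulli k) = (if n = 0 then 1 else 0)"
proof (cases "n = 0")
  case False
  then have "real (Suc n) * bernoulli n = - (\<Sum>k<n. real (Suc n choose k) * bernoulli k)"
    by (subst bernoulli.simps) (simp del: of_nat_Suc)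
  then show ?thesis
    using False by (simp add: atMost_Suc lessThan_Suc_atMost[symmetric])
qed (simp add: bernoulli.simps)

text \<open>The Bernoulli recursion, as the statement that their exponential generating function is
  \<open>X / (exp X - 1)\<close>.\<close>
lemma fps_X_eq_bernoulli_fps_mult: "fps_X = (fps_exp 1 - 1) * bernoulli_fps"
proof (rule fps_ext)
  fix n
  show "fps_X $ n = ((fps_exp 1 - 1) * bernoulli_fps) $ n"
  proof (cases n)
    case (Suc m)
    have "(bernoulli_fps * (fps_exp 1 - 1)) $ n
        = (\<Sum>k\<le>m. bernoulli k / fact k * (1 / fact (Suc m - k)))"
      unfolding Suc fps_mult_nth atLeast0AtMost
      by (simp add: bernoulli_fps_def Suc_diff_le mult_ac del: fact_Suc)
    also have "\<dots> = (\<Sum>k\<le>m. real (Suc m choose k) * bernoulli k / fact (Suc m))"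
      by (intro sum.cong refl) (simp add: binomial_fact field_simps del: fact_Suc)
    also have "\<dots> = (if m = 0 then 1 else 0)"
      by (simp add: bernoulli_sum flip: sum_divide_distrib)
    finally show ?thesis using Suc by (simp add: mult.commute fps_X_nth)
  qed simp
qed

context commuting_derivations
begin

text \<open>With \<open>\<omega>\<close> the generating series of the \<open>\<mu> n\<close>, the recursion reads
  \<open>\<omega>\<^sub>j = (X / (exp X - 1))(T) (t v\<^sub>j)\<close>. Since \<open>T x\<^sub>j = \<omega>\<^sub>j\<close>, applying \<open>(exp X - 1) / X\<close> turns it into
  \<open>exp \<omega> x\<^sub>j - x\<^sub>j = t v\<^sub>j\<close>, the hypothesis of \<open>log_taylor\<close>.\<close>
theorem log_taylor_eq_magnus:
  fixes \<mu> :: "nat \<Rightarrow> 'j \<Rightarrow> 'a" and v :: "'j \<Rightarrow> 'a"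
  assumes \<mu>_1: "\<mu> 1 = v"
    and \<mu>: "\<And>n j. 2 \<le> n \<Longrightarrow> \<mu> n j = (\<Sum>k=1..n-1. of_real (bernoulli k / fact k) *
        (\<Sum>is\<in>compositions k (n - 1). foldr (\<lambda>i. along (\<mu> i)) is (v j)))"
    and n: "1 \<le> n"
  shows "(\<Sum>k=1..n. of_real ((- 1) ^ (k - 1) / real k) * (\<Sum>is\<in>compositions k n. foldr (taylor v) is a))
    = along (\<mu> n) a"
proof -
  define \<omega> where "\<omega> = (\<lambda>j. Abs_fps (\<lambda>n. if n = 0 then 0 else \<mu> n j))"
  interpret formal_vector_field D x \<omega>
    by unfold_locales (simp add: \<omega>_def)
  have graded: "T = graded (\<lambda>i. along (\<mu> i))"
  proof (intro ext fps_ext)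
    fix F n
    have "T F $ n = (\<Sum>i=0..n. \<Sum>j\<in>UNIV. \<omega> j $ i * D j (F $ (n - i)))"
      by (simp add: lift_along_def fps_sum_nth fps_mult_nth) (rule sum.swap)
    also have "\<dots> = (\<Sum>i=1..n. \<Sum>j\<in>UNIV. \<omega> j $ i * D j (F $ (n - i)))"
      by (rule sum.mono_neutral_right) (auto simp: \<omega>_def not_less_eq_eq)
    also have "\<dots> = graded (\<lambda>i. along (\<mu> i)) F $ n"
      by (auto simp: graded_nth along_def \<omega>_def intro!: sum.cong)
    finally show "T F $ n = graded (\<lambda>i. along (\<mu> i)) F $ n" .
  qed
  have pow: "(T ^^ k) (fps_X * fps_const a) $ Suc n = (\<Sum>is\<in>compositions k n. foldr (\<lambda>i. along (\<mu> i)) is a)" for k n a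
    using pow_fps_X_power_mult[of k 1 "fps_const a"]
    by (simp add: graded graded_pow_const along_add)
  have magnus_eq: "\<omega> j = act bernoulli_fps (fps_X * fps_const (v j))" for j
  proof (rule fps_ext)
    fix n
    show "\<omega> j $ n = act bernoulli_fps (fps_X * fps_const (v j)) $ n"
    proof (cases n)
      case 0
      have "act bernoulli_fps (fps_X * fps_const (v j)) $ 0 = 0"
        by (simp add: act_nth[of 0 0])
      then show ?thesis using 0 \<omega>_nth_0[of j] by simp
    next
      case (Suc m)
      have "act bernoulli_fps (fps_X * fps_const (v j)) $ n
          = (\<Sum>k\<le>m. of_real (bernoulli k / fact k) * (\<Sum>is\<in>compositions k m. foldr (\<lambda>i. along (\<mu> i)) is (v j)))"
        unfolding Suc act_def fps_nth_Abs_fps pow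
        by (simp add: bernoulli_fps_def compositions_eq_empty)
      also have "\<dots> = \<mu> n j"
      proof (cases "m = 0")
        case True
        then show ?thesis using Suc \<mu>_1 by (simp add: compositions_0 bernoulli.simps)
      next
        case False
        have "(\<Sum>k\<le>m. of_real (bernoulli k / fact k) * (\<Sum>is\<in>compositions k m. foldr (\<lambda>i. along (\<mu> i)) is (v j)))
          = (\<Sum>k=1..m. of_real (bernoulli k / fact k) * (\<Sum>is\<in>compositions k m. foldr (\<lambda>i. along (\<mu> i)) is (v j)))"
          by (rule sum.mono_neutral_right) (use False in \<open>auto simp: compositions_0 not_less_eq_eq\<close>)
        then show ?thesis using \<mu>[of n j] Suc False by simp
      qed
      finally show ?thesis using Suc by (simp add: \<omega>_def)
    qed
  qed
  have "flow (fps_const (x j)) = fps_const (x j) + fps_X * fps_const (v j)" for j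
  proof -
    have "T (fps_const (x j)) = (\<Sum>i\<in>UNIV. \<omega> i * (if i = j then 1 else 0))"
      by (auto simp: lift_along_def lift_D_const D_coordinate intro!: sum.cong)
    also have "\<dots> = \<omega> j"
      by (subst sum.remove[of _ j]) (auto intro!: sum.neutral)
    finally have Tx: "T (fps_const (x j)) = \<omega> j" .
    \<comment> \<open>the series \<open>(exp X - 1) / X\<close>\<close>
    define P where "P = fps_shift 1 (fps_exp 1 - 1 :: real fps)"
    have P: "fps_exp 1 - 1 = P * fps_X"
    proof (rule fps_ext)
      show "(fps_exp 1 - 1) $ n = (P * fps_X) $ n" for n
        unfolding P_def by (cases n) simp_all
    qed
    have "fps_X * (P * bernoulli_fps) = fps_X * 1"
      using fps_X_eq_bernoulli_fps_mult P by (simp add: mult_ac)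
    then have PB: "P * bernoulli_fps = 1"
      by (subst (asm) mult_cancel_left) simp
    have "flow (fps_const (x j)) - fps_const (x j) = act (P * fps_X) (fps_const (x j))"
      by (simp add: flow_def act_diff_left act_one flip: P)
    also have "\<dots> = act P (act bernoulli_fps (fps_X * fps_const (v j)))"
      by (simp only: act_mult act_fps_X Tx flip: magnus_eq)
    also have "\<dots> = fps_X * fps_const (v j)"
      by (simp only: PB act_one flip: act_mult)
    finally show ?thesis by (simp add: algebra_simps)
  qed
  then show ?thesis
    using log_taylor[where v = v and n = n and a = a] n by (simp add: \<omega>_def)
qed

end

unbundle no fps_syntax
unbundle vec_syntax

section \<open>Symmetry of second partial derivatives\<close>

lemma partial_has_derivative_along_line:
  fixes f :: "real^'n \<Rightarrow> real"
  assumes "f differentiable at (x + t *\<^sub>R axis j 1)"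
  shows "((\<lambda>t. f (x + t *\<^sub>R axis j 1)) has_field_derivative partial j f (x + t *\<^sub>R axis j 1)) (at t)"
proof -
  have "((\<lambda>s. f ((x + t *\<^sub>R axis j 1) + s *\<^sub>R axis j 1)) has_field_derivative
      partial j f (x + t *\<^sub>R axis j 1)) (at (t + - t))"
    using line_has_derivative[OF assms] by simp
  then show ?thesis
    by (subst (asm) DERIV_shift) (simp add: algebra_simps)
qed

text \<open>The second difference is symmetric in the two directions, and applying the mean value theorem
  twice expresses it by either mixed derivative at a nearby point. Letting \<open>h\<close> shrink gives
  \<open>partial_commute\<close>.\<close>
lemma second_difference_eq_mixed_partial:
  fixes f :: "real^'n \<Rightarrow> real"
  assumes f: "smooth f" and h: "0 < h"
  shows "\<exists>s t. 0 < s \<and> s < h \<and> 0 < t \<and> t < h \<and>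
    f (x + h *\<^sub>R axis j 1 + h *\<^sub>R axis k 1) - f (x + h *\<^sub>R axis j 1) - f (x + h *\<^sub>R axis k 1) + f x
      = h * h * partial k (partial j f) (x + s *\<^sub>R axis j 1 + t *\<^sub>R axis k 1)"
proof -
  let ?j = "axis j 1 :: real^'n" and ?k = "axis k 1 :: real^'n"
  let ?p = "\<lambda>s. f (x + s *\<^sub>R ?j + h *\<^sub>R ?k) - f (x + s *\<^sub>R ?j)"
  let ?p' = "\<lambda>s. partial j f (x + s *\<^sub>R ?j + h *\<^sub>R ?k) - partial j f (x + s *\<^sub>R ?j)"
  note diff = smooth_differentiable[OF f] smooth_differentiable[OF smooth_partial[OF f]]
  have p: "(?p has_field_derivative ?p' s) (at s)" for s
    using partial_has_derivative_along_line[of f "x + h *\<^sub>R ?k" s j]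
      partial_has_derivative_along_line[of f x s j] diff
    by (intro DERIV_diff) (simp_all add: algebra_simps)
  obtain s where s: "0 < s" "s < h" "?p h - ?p 0 = h * ?p' s"
    using MVT2[OF h, of ?p ?p'] p by auto
  obtain t where t: "0 < t" "t < h"
    "partial j f (x + s *\<^sub>R ?j + h *\<^sub>R ?k) - partial j f (x + s *\<^sub>R ?j + 0 *\<^sub>R ?k)
      = h * partial k (partial j f) (x + s *\<^sub>R ?j + t *\<^sub>R ?k)"
    using MVT2[OF h, of "\<lambda>t. partial j f (x + s *\<^sub>R ?j + t *\<^sub>R ?k)"
        "\<lambda>t. partial k (partial j f) (x + s *\<^sub>R ?j + t *\<^sub>R ?k)"]
      partial_has_derivative_along_line[OF diff(2)] by auto
  show ?thesis
    using s t by (intro exI[of _ s] exI[of _ t]) (simp add: algebra_simps)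
qed

lemma partial_commute:
  assumes f: "smooth f"
  shows "partial j (partial k f) = partial k (partial j f)"
proof (rule ext, rule ccontr)
  fix x
  let ?a = "partial j (partial k f)" and ?b = "partial k (partial j f)"
  let ?j = "axis j 1 :: real^'a" and ?k = "axis k 1 :: real^'a"
  assume ne: "?a x \<noteq> ?b x"
  define e where "e = dist (?a x) (?b x) / 2"
  have e: "e > 0" using ne by (simp add: e_def)
  have "isCont ?a x" "isCont ?b x"
    by (intro differentiable_imp_continuous_within smooth_differentiable smooth_partial f)+
  then obtain da db where d: "da > 0" "\<And>y. dist y x < da \<Longrightarrow> dist (?a y) (?a x) < e"
      "db > 0" "\<And>y. dist y x < db \<Longrightarrow> dist (?b y) (?b x) < e"
    unfolding continuous_at_eps_delta using e by metis
  define h where "h = min da db / 2"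
  have h: "h > 0" using d by (simp add: h_def)
  have near: "dist (x + u + v) x < min da db" if "norm u < h" "norm v < h" for u v
    using norm_triangle_ineq[of u v] that by (simp add: dist_norm h_def)
  obtain s t where st: "0 < s" "s < h" "0 < t" "t < h"
    "f (x + h *\<^sub>R ?j + h *\<^sub>R ?k) - f (x + h *\<^sub>R ?j) - f (x + h *\<^sub>R ?k) + f x
      = h * h * ?b (x + s *\<^sub>R ?j + t *\<^sub>R ?k)"
    using second_difference_eq_mixed_partial[OF f h] by blast
  obtain s' t' where st': "0 < s'" "s' < h" "0 < t'" "t' < h"
    "f (x + h *\<^sub>R ?k + h *\<^sub>R ?j) - f (x + h *\<^sub>R ?k) - f (x + h *\<^sub>R ?j) + f x
      = h * h * ?a (x + s' *\<^sub>R ?k + t' *\<^sub>R ?j)"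
    using second_difference_eq_mixed_partial[OF f h] by blast
  have "h * h * ?a (x + s' *\<^sub>R ?k + t' *\<^sub>R ?j) = h * h * ?b (x + s *\<^sub>R ?j + t *\<^sub>R ?k)"
    using st(5) st'(5) unfolding add.assoc[of x] add.commute[of "h *\<^sub>R ?k"] by linarith
  then have "?a (x + s' *\<^sub>R ?k + t' *\<^sub>R ?j) = ?b (x + s *\<^sub>R ?j + t *\<^sub>R ?k)"
    using h by simp
  moreover have "dist (?a (x + s' *\<^sub>R ?k + t' *\<^sub>R ?j)) (?a x) < e"
    using near[of "s' *\<^sub>R ?k" "t' *\<^sub>R ?j"] st' by (intro d) simp
  moreover have "dist (?b (x + s *\<^sub>R ?j + t *\<^sub>R ?k)) (?b x) < e"
    using near[of "s *\<^sub>R ?j" "t *\<^sub>R ?k"] st by (intro d) simp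
  ultimately have "dist (?a x) (?b x) < dist (?a x) (?b x)"
    unfolding e_def by (metis dist_triangle_half_r)
  then show False by simp
qed

section \<open>Real analytic functions\<close>

definition monomial :: "('n::finite \<Rightarrow> nat) \<Rightarrow> real^'n \<Rightarrow> real" where
  "monomial \<alpha> z = (\<Prod>j\<in>UNIV. (z $ j) ^ \<alpha> j)"

lemma real_analytic_iff:
  "real_analytic f \<longleftrightarrow>
    (\<forall>x. \<exists>r>0. \<exists>c. \<forall>y\<in>ball x r. ((\<lambda>\<alpha>. c \<alpha> * monomial \<alpha> (y - x)) has_sum f y) UNIV)"
  by (simp add: real_analytic_def monomial_def)

lemma real_analytic_const: "real_analytic (\<lambda>x. a)"
  unfolding real_analytic_iff
proof
  fix x :: "real^'n"
  let ?c = "\<lambda>\<alpha> :: 'n \<Rightarrow> nat. if \<alpha> = (\<lambda>_. 0) then a else 0"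
  have "((\<lambda>\<alpha>. ?c \<alpha> * monomial \<alpha> (y - x)) has_sum a) UNIV" for y
    by (rule has_sum_finite_neutralI[where B = "{\<lambda>_. 0}"]) (auto simp: monomial_def)
  then show "\<exists>r>0. \<exists>c. \<forall>y\<in>ball x r. ((\<lambda>\<alpha>. c \<alpha> * monomial \<alpha> (y - x)) has_sum a) UNIV"
    by (intro exI[of _ 1] conjI exI[of _ ?c] ballI) simp_all
qed

lemma real_analytic_add:
  assumes "real_analytic f" "real_analytic g"
  shows "real_analytic (\<lambda>x. f x + g x)"
  unfolding real_analytic_iff
proof
  fix x
  obtain r c where r: "r > 0" "\<And>y. y \<in> ball x r \<Longrightarrow> ((\<lambda>\<alpha>. c \<alpha> * monomial \<alpha> (y - x)) has_sum f y) UNIV"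
    using assms(1) unfolding real_analytic_iff by blast
  obtain s d where s: "s > 0" "\<And>y. y \<in> ball x s \<Longrightarrow> ((\<lambda>\<alpha>. d \<alpha> * monomial \<alpha> (y - x)) has_sum g y) UNIV"
    using assms(2) unfolding real_analytic_iff by blast
  show "\<exists>r>0. \<exists>c. \<forall>y\<in>ball x r. ((\<lambda>\<alpha>. c \<alpha> * monomial \<alpha> (y - x)) has_sum f y + g y) UNIV"
  proof (intro exI conjI ballI)
    show "min r s > 0" using r s by simp
    fix y assume "y \<in> ball x (min r s)"
    then show "((\<lambda>\<alpha>. (c \<alpha> + d \<alpha>) * monomial \<alpha> (y - x)) has_sum f y + g y) UNIV"
      unfolding distrib_right by (intro has_sum_add r s) auto
  qed
qed

lemma has_sum_mult_real:
  fixes a :: "'i \<Rightarrow> real" and b :: "'k \<Rightarrow> real"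
  assumes a: "(a has_sum A) I" and b: "(b has_sum B) K"
  shows "((\<lambda>(i, k). a i * b k) has_sum A * B) (I \<times> K)"
proof (rule has_sum_SigmaI)
  show "((\<lambda>k. case (i, k) of (i, k) \<Rightarrow> a i * b k) has_sum a i * B) K" for i
    using has_sum_cmult_right[OF b] by simp
  show "((\<lambda>i. a i * B) has_sum A * B) I"
    by (rule has_sum_cmult_left[OF a])
  have abs: "(\<lambda>i. norm (a i)) summable_on I" "(\<lambda>k. norm (b k)) summable_on K"
    by (rule summable_on_iff_abs_summable_on_real[THEN iffD1, OF has_sum_imp_summable[OF a]],
        rule summable_on_iff_abs_summable_on_real[THEN iffD1, OF has_sum_imp_summable[OF b]])
  have "(\<lambda>x. norm ((\<lambda>(i, k). a i * b k) x)) summable_on I \<times> K"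
    unfolding Infinite_Sum.abs_summable_on_Sigma_iff
    using abs by (auto simp: abs_mult infsum_cmult_right' summable_on_cmult_right summable_on_cmult_left)
  then show "(\<lambda>(i, k). a i * b k) summable_on I \<times> K"
    by (rule abs_summable_summable)
qed

lemma finite_multi_indices_below: "finite {\<alpha> :: 'n::finite \<Rightarrow> nat. \<forall>j. \<alpha> j \<le> \<gamma> j}"
proof -
  have "{\<alpha> :: 'n \<Rightarrow> nat. \<forall>j. \<alpha> j \<le> \<gamma> j} = PiE UNIV (\<lambda>j. {..\<gamma> j})"
    by (auto simp: PiE_def Pi_def)
  then show ?thesis by (simp add: finite_PiE)
qed

text \<open>The Cauchy product: the absolutely convergent double series is regrouped by the sum \<open>\<gamma>\<close> of the two
  multi-indices, and each group is finite.\<close>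
lemma real_analytic_mult:
  assumes "real_analytic f" "real_analytic g"
  shows "real_analytic (\<lambda>x. f x * g x)"
  unfolding real_analytic_iff
proof
  fix x
  obtain r c where r: "r > 0" "\<And>y. y \<in> ball x r \<Longrightarrow> ((\<lambda>\<alpha>. c \<alpha> * monomial \<alpha> (y - x)) has_sum f y) UNIV"
    using assms(1) unfolding real_analytic_iff by blast
  obtain s d where s: "s > 0" "\<And>y. y \<in> ball x s \<Longrightarrow> ((\<lambda>\<alpha>. d \<alpha> * monomial \<alpha> (y - x)) has_sum g y) UNIV"
    using assms(2) unfolding real_analytic_iff by blast
  let ?below = "\<lambda>\<gamma> :: 'a \<Rightarrow> nat. {\<alpha>. \<forall>j. \<alpha> j \<le> \<gamma> j}"
  let ?e = "\<lambda>\<gamma>. \<Sum>\<alpha>\<in>?below \<gamma>. c \<alpha> * d (\<lambda>j. \<gamma> j - \<alpha> j)"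
  show "\<exists>r>0. \<exists>c. \<forall>y\<in>ball x r. ((\<lambda>\<alpha>. c \<alpha> * monomial \<alpha> (y - x)) has_sum f y * g y) UNIV"
  proof (intro exI conjI ballI)
    show "min r s > 0" using r s by simp
    fix y assume y: "y \<in> ball x (min r s)"
    let ?z = "y - x"
    have "((\<lambda>(\<alpha>, \<beta>). (c \<alpha> * monomial \<alpha> ?z) * (d \<beta> * monomial \<beta> ?z)) has_sum f y * g y) (UNIV \<times> UNIV)"
      by (intro has_sum_mult_real r s) (use y in auto)
    also have "?this \<longleftrightarrow> ((\<lambda>(\<gamma>, \<alpha>). c \<alpha> * d (\<lambda>j. \<gamma> j - \<alpha> j) * monomial \<gamma> ?z) has_sum f y * g y)
        (Sigma UNIV ?below)"
    proof (rule has_sum_reindex_bij_witness[where i = "\<lambda>(\<gamma>, \<alpha>). (\<alpha>, \<lambda>j. \<gamma> j - \<alpha> j)"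
          and j = "\<lambda>(\<alpha>, \<beta>). (\<lambda>j. \<alpha> j + \<beta> j, \<alpha>)"])
      show "(case (case a of (\<alpha>, \<beta>) \<Rightarrow> (\<lambda>j. \<alpha> j + \<beta> j, \<alpha>)) of (\<gamma>, \<alpha>) \<Rightarrow>
          c \<alpha> * d (\<lambda>j. \<gamma> j - \<alpha> j) * monomial \<gamma> ?z)
        = (case a of (\<alpha>, \<beta>) \<Rightarrow> (c \<alpha> * monomial \<alpha> ?z) * (d \<beta> * monomial \<beta> ?z))" for a
        by (cases a) (simp add: monomial_def power_add prod.distrib)
    qed auto
    finally show "((\<lambda>\<gamma>. ?e \<gamma> * monomial \<gamma> ?z) has_sum f y * g y) UNIV"
      by (rule has_sum_SigmaD)
         (auto simp: sum_distrib_right finite_multi_indices_below intro!: has_sum_finiteI)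
  qed
qed

lemma partial_eq_derivative:
  assumes "(f has_derivative f') (at y)"
  shows "partial k f y = f' (axis k 1)"
proof -
  have "((\<lambda>t. y + t *\<^sub>R axis k 1) has_derivative (\<lambda>t. t *\<^sub>R axis k 1)) (at (0::real))"
    by (auto intro!: derivative_eq_intros)
  then have "((\<lambda>t. f (y + t *\<^sub>R axis k 1)) has_derivative (\<lambda>t. f' (t *\<^sub>R axis k 1))) (at (0::real))"
    using has_derivative_compose[of "\<lambda>t. y + t *\<^sub>R axis k 1" _ 0 UNIV f f'] assms by simp
  moreover have "f' (t *\<^sub>R axis k 1) = f' (axis k 1) * t" for t
    using has_derivative_bounded_linear[OF assms] by (simp add: linear_cmul bounded_linear.linear)
  ultimately have "((\<lambda>t. f (y + t *\<^sub>R axis k 1)) has_field_derivative f' (axis k 1)) (at 0)"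
    by (simp add: has_field_derivative_def)
  then show ?thesis
    unfolding partial_def by (rule DERIV_imp_deriv)
qed

text \<open>For \<open>\<alpha> k = 0\<close> the truncated exponent is harmless, as the factor \<open>\<alpha> k\<close> vanishes.\<close>
definition monomial_partial :: "'n \<Rightarrow> ('n::finite \<Rightarrow> nat) \<Rightarrow> real^'n \<Rightarrow> real" where
  "monomial_partial k \<alpha> z = real (\<alpha> k) * monomial (\<alpha>(k := \<alpha> k - 1)) z"

lemma has_derivative_monomial:
  "((\<lambda>y. monomial \<alpha> (y - x)) has_derivative (\<lambda>h. \<Sum>k\<in>UNIV. monomial_partial k \<alpha> (y - x) * h $ k)) (at y within S)"
proof -
  have "((\<lambda>y. \<Prod>j\<in>UNIV. (y $ j - x $ j) ^ \<alpha> j) has_derivative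
      (\<lambda>h. \<Sum>k\<in>UNIV. (real (\<alpha> k) * h $ k * (y $ k - x $ k) ^ (\<alpha> k - 1))
         * (\<Prod>j\<in>UNIV - {k}. (y $ j - x $ j) ^ \<alpha> j))) (at y within S)"
    by (intro has_derivative_prod)
       (auto intro!: derivative_eq_intros bounded_linear_imp_has_derivative bounded_linear_vec_nth)
  moreover have "real (\<alpha> k) * h $ k * (y $ k - x $ k) ^ (\<alpha> k - 1)
         * (\<Prod>j\<in>UNIV - {k}. (y $ j - x $ j) ^ \<alpha> j) = monomial_partial k \<alpha> (y - x) * h $ k" for k h
  proof -
    have "monomial (\<alpha>(k := \<alpha> k - 1)) (y - x)
        = (y $ k - x $ k) ^ (\<alpha> k - 1) * (\<Prod>j\<in>UNIV - {k}. (y $ j - x $ j) ^ \<alpha> j)"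
      unfolding monomial_def by (subst prod.remove[of _ k]) (auto intro!: prod.cong)
    then show ?thesis by (simp add: monomial_partial_def mult_ac)
  qed
  ultimately show ?thesis by (simp only: monomial_def vector_minus_component)
qed

text \<open>Halving the radius pays for the factor \<open>\<alpha>\<^sub>k \<le> 2\<^sup>|\<^sup>\<alpha>\<^sup>|\<close> that differentiation produces, so the
  differentiated series is dominated by the original one at radius \<open>\<rho>\<close>.\<close>
lemma monomial_partial_bound:
  assumes \<rho>: "\<rho> > 0" and z: "\<And>j. \<bar>z $ j\<bar> \<le> \<rho> / 2"
  shows "\<bar>monomial_partial k \<alpha> z\<bar> \<le> 2 / \<rho> * \<rho> ^ (\<Sum>j\<in>UNIV. \<alpha> j)"
proof (cases "\<alpha> k = 0")
  case True
  then show ?thesis using \<rho> by (simp add: monomial_partial_def)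
next
  case False
  let ?\<beta> = "\<alpha>(k := \<alpha> k - 1)" and ?n = "\<Sum>j\<in>UNIV. \<alpha> j"
  have n: "?n = Suc (\<Sum>j\<in>UNIV. ?\<beta> j)"
    using False by (subst (1 2) sum.remove[of _ k]) auto
  have "\<bar>monomial ?\<beta> z\<bar> = (\<Prod>j\<in>UNIV. \<bar>z $ j\<bar> ^ ?\<beta> j)"
    by (simp only: monomial_def abs_prod power_abs)
  also have "\<dots> \<le> (\<Prod>j\<in>UNIV. (\<rho> / 2) ^ ?\<beta> j)"
    by (intro prod_mono conjI power_mono z) auto
  also have "\<dots> = (\<rho> / 2) ^ (\<Sum>j\<in>UNIV. ?\<beta> j)"
    by (simp only: power_sum)
  finally have mono: "\<bar>monomial ?\<beta> z\<bar> \<le> (\<rho> / 2) ^ (\<Sum>j\<in>UNIV. ?\<beta> j)" .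
  have "\<alpha> k \<le> ?n" by (rule member_le_sum) auto
  also have "?n \<le> 2 ^ ?n" by (simp add: less_imp_le)
  finally have "real (\<alpha> k) \<le> 2 ^ ?n"
    by (metis of_nat_le_iff of_nat_numeral of_nat_power)
  then have "\<bar>monomial_partial k \<alpha> z\<bar> \<le> 2 ^ ?n * (\<rho> / 2) ^ (\<Sum>j\<in>UNIV. ?\<beta> j)"
    unfolding monomial_partial_def abs_mult using mono by (intro mult_mono) auto
  also have "\<dots> = 2 / \<rho> * \<rho> ^ ?n"
    using \<rho> unfolding n by (simp add: power_divide)
  finally show ?thesis .
qed

text \<open>Series of functions can be differentiated term by term when they are indexed by natural numbers;
  unconditional convergence makes the order of the multi-indices irrelevant.\<close>
lemma ex_enumeration_multi_indices: "\<exists>e :: nat \<Rightarrow> ('n::finite \<Rightarrow> nat). bij e"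
proof -
  have "inj (\<lambda>(n::nat) (_::'n). n)"
    by (auto simp: inj_on_def fun_eq_iff)
  then have "infinite (UNIV :: ('n \<Rightarrow> nat) set)"
    by (meson finite_subset infinite_UNIV_nat finite_imageD subset_UNIV)
  then show ?thesis
    using bij_betw_from_nat_into[of "UNIV :: ('n \<Rightarrow> nat) set"] by auto
qed

text \<open>Convergence at the diagonal point \<open>x + (\<rho>, \<dots>, \<rho>)\<close> bounds all coefficients at once. On the ball of
  radius \<open>\<rho> / 2\<close> the differentiated series then converges uniformly. The derivative is expanded around
  the same centre \<open>x\<close>, so no power series has to be re-centred.\<close>
lemma power_series_termwise_partial:
  fixes f :: "real^'n \<Rightarrow> real"
  assumes r: "r > 0"
    and f: "\<And>y. y \<in> ball x r \<Longrightarrow> ((\<lambda>\<alpha>. c \<alpha> * monomial \<alpha> (y - x)) has_sum f y) UNIV"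
  shows "\<exists>s>0. \<forall>y\<in>ball x s. f differentiable at y \<and>
    (\<forall>k. ((\<lambda>\<alpha>. c \<alpha> * monomial_partial k \<alpha> (y - x)) has_sum partial k f y) UNIV)"
proof -
  \<comment> \<open>small enough for the diagonal point to lie in the ball: its distance from \<open>x\<close> is at most
    \<open>CARD('n) * \<rho> = r / 2\<close>\<close>
  define \<rho> where "\<rho> = r / (2 * real CARD('n))"
  have \<rho>: "\<rho> > 0" using r by (simp add: \<rho>_def)
  define p :: "real^'n" where "p = (\<chi> j. \<rho>)"
  have "norm p \<le> (\<Sum>j\<in>UNIV. \<bar>p $ j\<bar>)" by (rule norm_le_l1_cart)
  also have "\<dots> = r / 2" using \<rho> by (simp add: p_def) (simp add: \<rho>_def)
  also have "\<dots> < r" using r by simp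
  finally have "x + p \<in> ball x r" by (simp add: dist_norm)
  then have "((\<lambda>\<alpha>. c \<alpha> * monomial \<alpha> p) has_sum f (x + p)) UNIV"
    using f[of "x + p"] by simp
  then have "(\<lambda>\<alpha>. norm (c \<alpha> * monomial \<alpha> p)) summable_on UNIV"
    by (rule summable_on_iff_abs_summable_on_real[THEN iffD1, OF has_sum_imp_summable])
  then have abs: "(\<lambda>\<alpha>. \<bar>c \<alpha>\<bar> * \<rho> ^ (\<Sum>j\<in>UNIV. \<alpha> j)) summable_on UNIV"
    using \<rho> by (simp add: abs_mult monomial_def p_def power_sum abs_prod)
  obtain e :: "nat \<Rightarrow> ('n \<Rightarrow> nat)" where e: "bij e"
    using ex_enumeration_multi_indices by blast
  define M where "M = (\<lambda>n. 2 / \<rho> * (\<bar>c (e n)\<bar> * \<rho> ^ (\<Sum>j\<in>UNIV. e n j)))"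
  have "(\<lambda>n. \<bar>c (e n)\<bar> * \<rho> ^ (\<Sum>j\<in>UNIV. e n j)) summable_on UNIV"
    using summable_on_reindex_bij_betw[OF e, of "\<lambda>\<alpha>. \<bar>c \<alpha>\<bar> * \<rho> ^ (\<Sum>j\<in>UNIV. \<alpha> j)"] abs by simp
  then have M: "summable M"
    unfolding M_def by (intro summable_mult summable_on_imp_summable)
  define S where "S = ball x (min r (\<rho> / 2))"
  have S: "x \<in> S" "open S" "convex S" "S \<subseteq> ball x r"
    using r \<rho> by (auto simp: S_def)
  define a where "a = (\<lambda>k n y. c (e n) * monomial_partial k (e n) (y - x))"
  have a_bound: "\<bar>a k n y\<bar> \<le> M n" if "y \<in> S" for k n y
  proof -
    have "\<bar>(y - x) $ j\<bar> \<le> \<rho> / 2" for j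
      using component_le_norm_cart[of "y - x" j] that by (simp add: S_def dist_norm norm_minus_commute)
    then have "\<bar>monomial_partial k (e n) (y - x)\<bar> \<le> 2 / \<rho> * \<rho> ^ (\<Sum>j\<in>UNIV. e n j)"
      by (rule monomial_partial_bound[OF \<rho>])
    then have "\<bar>c (e n)\<bar> * \<bar>monomial_partial k (e n) (y - x)\<bar> \<le> \<bar>c (e n)\<bar> * (2 / \<rho> * \<rho> ^ (\<Sum>j\<in>UNIV. e n j))"
      by (rule mult_left_mono) simp
    then show ?thesis by (simp add: a_def M_def abs_mult mult_ac)
  qed
  define G where "G = (\<lambda>k y. suminf (\<lambda>n. a k n y))"
  have unif: "uniform_limit S (\<lambda>n y. \<Sum>i<n. a k i y) (G k) sequentially" for k
    unfolding G_def by (rule Weierstrass_m_test[OF _ M]) (simp add: a_bound)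
  have sums: "(\<lambda>n. c (e n) * monomial (e n) (y - x)) sums f y" if "y \<in> S" for y
    using f[of y] that S(4) has_sum_reindex_bij_betw[OF e, of "\<lambda>\<alpha>. c \<alpha> * monomial \<alpha> (y - x)" "f y"]
    by (intro has_sum_imp_sums) auto
  have "\<exists>g. \<forall>y\<in>S. (\<lambda>n. c (e n) * monomial (e n) (y - x)) sums g y \<and>
      (g has_derivative (\<lambda>h. \<Sum>k\<in>UNIV. G k y * h $ k)) (at y within S)"
  proof (rule has_derivative_series)
    show "convex S" "x \<in> S" "(\<lambda>n. c (e n) * monomial (e n) (x - x)) sums f x"
      by (fact S sums[OF S(1)])+
    show "((\<lambda>y. c (e n) * monomial (e n) (y - x)) has_derivative (\<lambda>h. \<Sum>k\<in>UNIV. a k n y * h $ k)) (at y within S)" for n y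
      using has_derivative_mult_right[OF has_derivative_monomial[of "e n" x y S], of "c (e n)"]
      by (simp add: a_def sum_distrib_left mult.assoc)
    show "\<forall>\<^sub>F n in sequentially. \<forall>y\<in>S. \<forall>h. norm ((\<Sum>i<n. \<Sum>k\<in>UNIV. a k i y * h $ k) - (\<Sum>k\<in>UNIV. G k y * h $ k)) \<le> \<epsilon> * norm h"
      if \<epsilon>: "\<epsilon> > 0" for \<epsilon>
    proof -
      have "\<forall>\<^sub>F n in sequentially. \<forall>k. \<forall>y\<in>S. dist (\<Sum>i<n. a k i y) (G k y) < \<epsilon> / real CARD('n)"
        using unif \<epsilon> by (intro eventually_all_finite) (auto simp: uniform_limit_iff)
      then show ?thesis
      proof (rule eventually_mono, intro ballI allI)
        fix n y and h :: "real^'n"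
        assume n: "\<forall>k. \<forall>y\<in>S. dist (\<Sum>i<n. a k i y) (G k y) < \<epsilon> / real CARD('n)" and y: "y \<in> S"
        have "(\<Sum>i<n. \<Sum>k\<in>UNIV. a k i y * h $ k) - (\<Sum>k\<in>UNIV. G k y * h $ k)
            = (\<Sum>k\<in>UNIV. ((\<Sum>i<n. a k i y) - G k y) * h $ k)"
          by (subst sum.swap) (simp add: left_diff_distrib sum_subtractf sum_distrib_right)
        also have "norm \<dots> \<le> (\<Sum>k\<in>(UNIV::'n set). \<epsilon> / real CARD('n) * norm h)"
        proof (rule sum_norm_le)
          fix k
          have "norm ((\<Sum>i<n. a k i y) - G k y) \<le> \<epsilon> / real CARD('n)"
            using n y by (metis dist_norm less_imp_le)
          then show "norm (((\<Sum>i<n. a k i y) - G k y) * h $ k) \<le> \<epsilon> / real CARD('n) * norm h"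
            unfolding norm_mult using component_le_norm_cart[of h k] \<epsilon> by (intro mult_mono) auto
        qed
        also have "\<dots> = \<epsilon> * norm h" by simp
        finally show "norm ((\<Sum>i<n. \<Sum>k\<in>UNIV. a k i y * h $ k) - (\<Sum>k\<in>UNIV. G k y * h $ k)) \<le> \<epsilon> * norm h" .
      qed
    qed
  qed
  then obtain g where g: "\<forall>y\<in>S. (\<lambda>n. c (e n) * monomial (e n) (y - x)) sums g y \<and>
      (g has_derivative (\<lambda>h. \<Sum>k\<in>UNIV. G k y * h $ k)) (at y within S)" ..
  have deriv: "(f has_derivative (\<lambda>h. \<Sum>k\<in>UNIV. G k y * h $ k)) (at y)" if "y \<in> S" for y
  proof (rule has_derivative_transform_within_open)
    show "(g has_derivative (\<lambda>h. \<Sum>k\<in>UNIV. G k y * h $ k)) (at y)"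
      using g[rule_format, OF that] by (simp only: at_within_open[OF that S(2)])
    show "g z = f z" if "z \<in> S" for z
      by (rule sums_unique2[OF conjunct1[OF g[rule_format, OF that]] sums[OF that]])
  qed (use S that in auto)
  have partial: "partial k f y = G k y" if "y \<in> S" for k y
  proof -
    have "partial k f y = (\<Sum>j\<in>UNIV. G j y * axis k 1 $ j)"
      by (rule partial_eq_derivative[OF deriv[OF that]])
    also have "\<dots> = G k y"
      by (subst sum.remove[of _ k]) (auto simp: axis_def intro!: sum.neutral)
    finally show ?thesis .
  qed
  have "((\<lambda>\<alpha>. c \<alpha> * monomial_partial k \<alpha> (y - x)) has_sum partial k f y) UNIV" if "y \<in> S" for k y
  proof -
    have summable: "summable (\<lambda>n. norm (a k n y))"
      by (rule summable_comparison_test'[OF M, of 0]) (simp add: a_bound that)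
    have "(\<lambda>n. a k n y) sums G k y"
      unfolding G_def by (rule summable_sums[OF summable_norm_cancel[OF summable]])
    with summable have "((\<lambda>n. a k n y) has_sum G k y) UNIV"
      by (rule norm_summable_imp_has_sum)
    then show ?thesis
      using has_sum_reindex_bij_betw[OF e, of "\<lambda>\<alpha>. c \<alpha> * monomial_partial k \<alpha> (y - x)"] partial[OF that]
      by (simp add: a_def)
  qed
  moreover have "min r (\<rho> / 2) > 0" using r \<rho> by simp
  ultimately show ?thesis
    using deriv unfolding S_def differentiable_def by blast
qed

lemma real_analytic_differentiable:
  assumes "real_analytic f"
  shows "f differentiable at x"
proof -
  obtain r c where "r > 0" "\<And>y. y \<in> ball x r \<Longrightarrow> ((\<lambda>\<alpha>. c \<alpha> * monomial \<alpha> (y - x)) has_sum f y) UNIV"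
    using assms unfolding real_analytic_iff by blast
  from power_series_termwise_partial[OF this] show ?thesis by (meson centre_in_ball)
qed

lemma real_analytic_partial:
  assumes "real_analytic f"
  shows "real_analytic (partial k f)"
  unfolding real_analytic_iff
proof
  fix x
  obtain r c where "r > 0" "\<And>y. y \<in> ball x r \<Longrightarrow> ((\<lambda>\<alpha>. c \<alpha> * monomial \<alpha> (y - x)) has_sum f y) UNIV"
    using assms unfolding real_analytic_iff by blast
  from power_series_termwise_partial[OF this] obtain s where s: "s > 0"
    "\<And>y. y \<in> ball x s \<Longrightarrow> ((\<lambda>\<alpha>. c \<alpha> * monomial_partial k \<alpha> (y - x)) has_sum partial k f y) UNIV"
    by blast
  let ?d = "\<lambda>\<beta>. real (Suc (\<beta> k)) * c (\<beta>(k := Suc (\<beta> k)))"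
  have "((\<lambda>\<beta>. ?d \<beta> * monomial \<beta> (y - x)) has_sum partial k f y) UNIV" if "y \<in> ball x s" for y
  proof -
    have "((\<lambda>\<alpha>. c \<alpha> * monomial_partial k \<alpha> (y - x)) has_sum partial k f y) UNIV \<longleftrightarrow>
        ((\<lambda>\<alpha>. c \<alpha> * monomial_partial k \<alpha> (y - x)) has_sum partial k f y) {\<alpha>. \<alpha> k > 0}"
      by (rule has_sum_cong_neutral) (auto simp: monomial_partial_def)
    also have "\<dots> \<longleftrightarrow> ((\<lambda>\<beta>. ?d \<beta> * monomial \<beta> (y - x)) has_sum partial k f y) UNIV"
      by (rule has_sum_reindex_bij_witness[where i = "\<lambda>\<beta>. \<beta>(k := Suc (\<beta> k))" and j = "\<lambda>\<alpha>. \<alpha>(k := \<alpha> k - 1)"])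
         (auto simp: monomial_partial_def fun_eq_iff)
    finally show ?thesis using s(2)[OF that] by blast
  qed
  then show "\<exists>r>0. \<exists>c. \<forall>y\<in>ball x r. ((\<lambda>\<alpha>. c \<alpha> * monomial \<alpha> (y - x)) has_sum partial k f y) UNIV"
    using s(1) by (intro exI[of _ s] conjI exI[of _ ?d] ballI)
qed

text \<open>Analyticity passes to all iterated partial derivatives, and each of them is differentiable.\<close>
lemma real_analytic_imp_smooth:
  assumes "real_analytic f"
  shows "smooth f"
proof -
  have "real_analytic (foldr partial js f)" for js
    using assms by (induction js) (auto intro: real_analytic_partial)
  then show ?thesis
    unfolding smooth_def
    using real_analytic_differentiable differentiable_at_imp_differentiable_on by blast
qed

lemma real_analytic_sum:
  "(\<And>i. i \<in> I \<Longrightarrow> real_analytic (f i)) \<Longrightarrow> real_analytic (\<lambda>x. \<Sum>i\<in>I. f i x)"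
  by (induction I rule: infinite_finite_induct) (auto intro: real_analytic_const real_analytic_add)

lemma analytic_vfield_imp_smooth: "analytic_vfield W \<Longrightarrow> smooth_vfield W"
  by (simp add: analytic_vfield_def smooth_vfield_def real_analytic_imp_smooth)

lemma analytic_vfield_prelie:
  assumes "analytic_vfield V" "analytic_vfield W"
  shows "analytic_vfield (prelie V W)"
  using assms unfolding analytic_vfield_def prelie_def
  by (auto intro!: real_analytic_sum real_analytic_mult real_analytic_partial)

lemma analytic_vfield_magnus:
  assumes "analytic_vfield a"
  shows "analytic_vfield (magnus n a)"
proof (induction n rule: less_induct)
  case (less n)
  consider "n = 0" | "n = 1" | "2 \<le> n" by linarith
  then show ?case
  proof cases
    case 1
    then show ?thesis by (simp add: magnus.simps analytic_vfield_def real_analytic_const)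
  next
    case 2
    then show ?thesis using assms by (simp add: magnus.simps)
  next
    case 3
    have part: "i < n" if "is \<in> compositions k (n - 1)" "i \<in> set is" for k i "is"
      using member_le_sum_list[of i "is"] that 3 by (auto simp: compositions_def)
    have "analytic_vfield (foldr (\<lambda>i W. prelie (magnus i a) W) is a)" if "\<forall>i\<in>set is. i < n" for "is"
      using that by (induction "is") (auto intro: analytic_vfield_prelie less.IH assms)
    then have "real_analytic (\<lambda>x. foldr (\<lambda>i W. prelie (magnus i a) W) is a x $ j)"
      if "is \<in> compositions k (n - 1)" for k j "is"
      using that part by (simp add: analytic_vfield_def)
    then have "real_analytic (\<lambda>x. \<Sum>k=1..n-1. bernoulli k / fact k *
        (\<Sum>is\<in>compositions k (n - 1). foldr (\<lambda>i W. prelie (magnus i a) W) is a x $ j))" for j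
      by (intro real_analytic_sum real_analytic_mult real_analytic_const)
    then show ?thesis
      using 3 by (subst magnus.simps) (simp add: analytic_vfield_def)
  qed
qed

section \<open>The algebra of smooth functions\<close>

lemma partial_coordinate: "partial k (\<lambda>x :: real^'n. x $ j) = (\<lambda>x. if k = j then 1 else 0)"
proof
  fix y :: "real^'n"
  have "((\<lambda>x. x $ j) has_derivative (\<lambda>x. x $ j)) (at y)" for j
    by (intro bounded_linear_imp_has_derivative bounded_linear_vec_nth)
  from partial_eq_derivative[OF this] show "partial k (\<lambda>x :: real^'n. x $ j) y = (if k = j then 1 else 0)"
    by (simp add: axis_def)
qed

lemma smooth_coordinate: "smooth (\<lambda>x :: real^'n. x $ j)"
proof -
  have "(\<lambda>x::real^'n. x $ j) differentiable_on UNIV"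
    by (simp add: bounded_linear_imp_differentiable_on bounded_linear_vec_nth)
  then have "smooth_upto n (\<lambda>x::real^'n. x $ j)" for n
    by (cases n) (auto simp: smooth_upto_0 smooth_upto_Suc partial_coordinate smooth_upto_const)
  then show ?thesis by (simp add: smooth_smooth_upto)
qed

text \<open>The action of \<open>partial\<close> is a derivation on smooth functions only; the type restricts to
  them, so that the abstract algebra applies.\<close>
typedef (overloaded) ('n::finite) smooth_fun = "{f :: real^'n \<Rightarrow> real. smooth f}"
  morphisms fun_of Smooth_fun
  by (auto intro: smooth_const)

setup_lifting type_definition_smooth_fun

lemma smooth_fun_of: "smooth (fun_of a)"
  using fun_of by blast

lemma smooth_fun_eqI: "(\<And>x. fun_of a x = fun_of b x) \<Longrightarrow> a = b"
  by (simp add: fun_of_inject[symmetric] fun_eq_iff)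

instantiation smooth_fun :: (finite) "{comm_ring_1, real_algebra_1}"
begin

lift_definition zero_smooth_fun :: "'a smooth_fun" is "\<lambda>_. 0" by (rule smooth_const)
lift_definition one_smooth_fun :: "'a smooth_fun" is "\<lambda>_. 1" by (rule smooth_const)
lift_definition plus_smooth_fun :: "'a smooth_fun \<Rightarrow> 'a smooth_fun \<Rightarrow> 'a smooth_fun"
  is "\<lambda>f g x. f x + g x" by (rule smooth_add)
lift_definition times_smooth_fun :: "'a smooth_fun \<Rightarrow> 'a smooth_fun \<Rightarrow> 'a smooth_fun"
  is "\<lambda>f g x. f x * g x" by (rule smooth_mult)
lift_definition scaleR_smooth_fun :: "real \<Rightarrow> 'a smooth_fun \<Rightarrow> 'a smooth_fun"
  is "\<lambda>r f x. r * f x" by (intro smooth_mult smooth_const)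
lift_definition uminus_smooth_fun :: "'a smooth_fun \<Rightarrow> 'a smooth_fun"
  is "\<lambda>f x. - 1 * f x" by (intro smooth_mult smooth_const)
lift_definition minus_smooth_fun :: "'a smooth_fun \<Rightarrow> 'a smooth_fun \<Rightarrow> 'a smooth_fun"
  is "\<lambda>f g x. f x + - 1 * g x" by (intro smooth_add smooth_mult smooth_const)

instance
  by standard (transfer; force simp: fun_eq_iff algebra_simps)+

end

lemma fun_of_sum: "fun_of (\<Sum>i\<in>I. a i) x = (\<Sum>i\<in>I. fun_of (a i) x)"
  by (induction I rule: infinite_finite_induct)
     (simp_all add: zero_smooth_fun.rep_eq plus_smooth_fun.rep_eq)

lemma fun_of_prod_list: "fun_of (\<Prod>i\<leftarrow>is. a i) x = (\<Prod>i\<leftarrow>is. fun_of (a i) x)"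
  by (induction "is") (simp_all add: one_smooth_fun.rep_eq times_smooth_fun.rep_eq)

lemma fun_of_of_real: "fun_of (of_real r) x = r"
  by (simp add: of_real_def scaleR_smooth_fun.rep_eq one_smooth_fun.rep_eq)

lift_definition D_smooth :: "'n::finite \<Rightarrow> 'n smooth_fun \<Rightarrow> 'n smooth_fun" is partial
  by (rule smooth_partial)

lift_definition coordinate :: "'n::finite \<Rightarrow> 'n smooth_fun" is "\<lambda>j x. x $ j"
  by (rule smooth_coordinate)

interpretation smooth_fun: commuting_derivations "D_smooth :: 'n::finite \<Rightarrow> _" coordinate
proof
  fix j k :: 'n and a b :: "'n smooth_fun" and r :: real
  note simps = D_smooth.rep_eq plus_smooth_fun.rep_eq times_smooth_fun.rep_eq
  have diff: "fun_of a differentiable at x" for a :: "'n smooth_fun" and x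
    by (rule smooth_differentiable[OF smooth_fun_of])
  show "D_smooth j (a + b) = D_smooth j a + D_smooth j b"
    by (rule smooth_fun_eqI) (simp add: simps partial_add diff)
  show "D_smooth j (a * b) = D_smooth j a * b + a * D_smooth j b"
    by (rule smooth_fun_eqI) (simp add: simps partial_mult diff)
  have "fun_of (of_real r :: 'n smooth_fun) = (\<lambda>x. r)"
    by (simp add: fun_eq_iff fun_of_of_real)
  then show "D_smooth j (of_real r) = 0"
    by (intro smooth_fun_eqI) (simp add: simps partial_const zero_smooth_fun.rep_eq)
  show "D_smooth j (D_smooth k a) = D_smooth k (D_smooth j a)"
    by transfer (rule partial_commute)
  show "D_smooth k (coordinate j) = (if k = j then 1 else 0)"
    by (rule smooth_fun_eqI)
       (simp add: simps coordinate.rep_eq partial_coordinate zero_smooth_fun.rep_eq one_smooth_fun.rep_eq)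
qed

lemma fun_of_foldr_D: "fun_of (foldr D_smooth js a) = foldr partial js (fun_of a)"
  by (induction js) (simp_all add: D_smooth.rep_eq)

section \<open>The Magnus components as vector fields\<close>

definition component_funs :: "('n::finite) vfield \<Rightarrow> 'n \<Rightarrow> 'n smooth_fun" where
  "component_funs W j = Smooth_fun (\<lambda>x. W x $ j)"

lemma fun_of_component_funs: "smooth_vfield W \<Longrightarrow> fun_of (component_funs W j) = (\<lambda>x. W x $ j)"
  by (simp add: component_funs_def Smooth_fun_inverse smooth_vfield_def)

lemma fun_of_along:
  "smooth_vfield W \<Longrightarrow> fun_of (smooth_fun.along (component_funs W) a) = vfield_op W (fun_of a)"
  by (simp add: fun_eq_iff smooth_fun.along_def fun_of_sum times_smooth_fun.rep_eq
      fun_of_component_funs D_smooth.rep_eq vfield_op_def)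

lemma along_component_funs:
  assumes "smooth_vfield U" "smooth_vfield W"
  shows "fun_of (smooth_fun.along (component_funs U) (component_funs W j)) = (\<lambda>x. prelie U W x $ j)"
  using assms by (simp add: fun_of_along fun_of_component_funs) (simp add: vfield_op_def prelie_def fun_eq_iff)

lemma fun_of_taylor:
  assumes "smooth_vfield (V i)"
  shows "fun_of (smooth_fun.taylor (component_funs (V i)) m a) = letter_op V (i, m) (fun_of a)"
  using assms
  by (simp add: fun_eq_iff smooth_fun.taylor_def fun_of_sum times_smooth_fun.rep_eq fun_of_of_real
      fun_of_prod_list fun_of_foldr_D fun_of_component_funs letter_op_def)

lemma fun_of_foldr_taylor:
  assumes "smooth_vfield (V i)"
  shows "fun_of (foldr (smooth_fun.taylor (component_funs (V i))) is a)
    = foldr (letter_op V) (map (Pair i) is) (fun_of a)"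
  by (induction "is") (simp_all add: fun_of_taylor assms)

text \<open>The pre-Lie product \<open>U \<triangleright> W\<close> differentiates each component of \<open>W\<close> along \<open>U\<close>, so the Magnus
  recursion holds for each component.\<close>
lemma component_funs_magnus:
  fixes W :: "('n::finite) vfield"
  assumes W: "analytic_vfield W" and n: "2 \<le> n"
  shows "component_funs (magnus n W) j = (\<Sum>k=1..n-1. of_real (bernoulli k / fact k) *
    (\<Sum>is\<in>compositions k (n - 1). foldr (\<lambda>i. smooth_fun.along (component_funs (magnus i W))) is (component_funs W j)))"
proof (rule smooth_fun_eqI)
  fix x
  note smooth = analytic_vfield_imp_smooth[OF analytic_vfield_magnus[OF W]]
  have fold: "analytic_vfield (foldr (\<lambda>i. prelie (magnus i W)) is W) \<and>
      foldr (\<lambda>i. smooth_fun.along (component_funs (magnus i W))) is (component_funs W j)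
        = component_funs (foldr (\<lambda>i. prelie (magnus i W)) is W) j" for "is"
  proof (induction "is")
    case (Cons i "is")
    then have an: "analytic_vfield (foldr (\<lambda>i. prelie (magnus i W)) is W)" by blast
    have an': "analytic_vfield (prelie (magnus i W) (foldr (\<lambda>i. prelie (magnus i W)) is W))"
      by (rule analytic_vfield_prelie[OF analytic_vfield_magnus[OF W] an])
    have "smooth_fun.along (component_funs (magnus i W)) (component_funs (foldr (\<lambda>i. prelie (magnus i W)) is W) j)
      = component_funs (prelie (magnus i W) (foldr (\<lambda>i. prelie (magnus i W)) is W)) j"
      by (rule smooth_fun_eqI)
         (simp add: along_component_funs smooth an an' analytic_vfield_imp_smooth fun_of_component_funs)
    then show ?case using Cons an' by simp
  qed (simp add: W)
  show "fun_of (component_funs (magnus n W) j) x = fun_of (\<Sum>k=1..n-1. of_real (bernoulli k / fact k) *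
    (\<Sum>is\<in>compositions k (n - 1). foldr (\<lambda>i. smooth_fun.along (component_funs (magnus i W))) is (component_funs W j))) x"
    using n
    by (simp add: fun_of_component_funs smooth analytic_vfield_imp_smooth fold fun_of_sum
        times_smooth_fun.rep_eq fun_of_of_real)
       (subst magnus.simps, simp)
qed

section \<open>Words, compositions and the conclusion\<close>

lemma alphabet_downward_closed:
  "d \<le> l \<Longrightarrow> (i, m) \<in> alphabet d l \<Longrightarrow> 1 \<le> k \<Longrightarrow> k \<le> m \<Longrightarrow> (i, k) \<in> alphabet d l"
  by (auto simp: alphabet_def)

text \<open>For \<open>i = 0\<close> and for \<open>1 \<le> i \<le> d\<close> many brackets vanish, but only when their total weight exceeds
  one, respectively two, and no letter of such a weight exists. Hence compositions of the weight of a
  letter never meet a vanishing bracket, and the three kinds of index need no separate treatment.\<close>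
lemma iter_bracket_map_Pair:
  assumes "d \<le> l" "is \<noteq> []" "\<forall>k\<in>set is. 1 \<le> k" "(i, sum_list is) \<in> alphabet d l"
  shows "iter_bracket d (map (Pair i) is) = letter_vec (i, sum_list is)"
  using assms
proof (induction "is")
  case (Cons k ks)
  show ?case
  proof (cases ks)
    case (Cons k' ks')
    have pos: "1 \<le> k" "1 \<le> sum_list ks"
      using Cons.prems(3) Cons by auto
    have mem: "(i, k + sum_list ks) \<in> alphabet d l"
      using Cons.prems(4) by simp
    then have "(i, sum_list ks) \<in> alphabet d l"
      using pos alphabet_downward_closed[OF \<open>d \<le> l\<close>] by simp
    then have "iter_bracket d (map (Pair i) ks) = letter_vec (i, sum_list ks)"
      using Cons.IH \<open>d \<le> l\<close> Cons.prems(3) Cons by simp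
    moreover have "letter_bracket d (i, k) (i, sum_list ks) = Some (i, k + sum_list ks)"
      using mem pos by (auto simp: letter_bracket_def alphabet_def)
    ultimately show ?thesis
      using Cons by (simp add: bracket_letter_vec)
  qed simp
qed simp

lemma bracket_words_eq:
  assumes d: "d \<le> l" and a: "(i, m) \<in> alphabet d l" and n: "1 \<le> n"
  shows "bracket_words d l n (i, m) = map (Pair i) ` compositions n m"
proof (intro equalityI subsetI)
  fix w assume w: "w \<in> bracket_words d l n (i, m)"
  then have w': "length w = n" "set w \<subseteq> alphabet d l" "iter_bracket d w = letter_vec (i, m)" "w \<noteq> []"
    using n by (auto simp: bracket_words_def)
  have eq: "sum_list (map snd w) = m" "\<forall>a\<in>set w. fst a = i"
    using iter_bracket_cases[OF w'(4), of d] w'(3) by auto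
  have "w = map (Pair i) (map snd w)"
    using eq(2) by (simp add: comp_def) (rule map_idI[symmetric], auto)
  moreover have "map snd w \<in> compositions n m"
    using w' eq by (auto simp: compositions_def alphabet_def)
  ultimately show "w \<in> map (Pair i) ` compositions n m" by blast
next
  fix w assume "w \<in> map (Pair i) ` compositions n m"
  then obtain "is" where w: "w = map (Pair i) is"
    and "is": "length is = n" "\<forall>k\<in>set is. 1 \<le> k" "sum_list is = m"
    by (auto simp: compositions_def)
  have "k \<le> m" if "k \<in> set is" for k
    using member_le_sum_list[of k "is"] that "is" by simp
  then have "set w \<subseteq> alphabet d l"
    using alphabet_downward_closed[OF d a] "is"(2) unfolding w by auto
  moreover have "iter_bracket d w = letter_vec (i, m)"
    using iter_bracket_map_Pair[of d l "is" i] "is" d a n unfolding w by fastforce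
  ultimately show "w \<in> bracket_words d l n (i, m)"
    using "is" w by (simp add: bracket_words_def)
qed

text \<open>Linearity in the free algebra does not involve the fields; stated for arbitrary \<open>V\<close>, it covers a
  family of which only the members up to \<open>l\<close> are smooth.\<close>
lemma mu_bar_linear:
  "mu_bar V (P + Q) f x = mu_bar V P f x + mu_bar V Q f x"
  "mu_bar V (Poly_Mapping.single w c) f x = c * foldr (letter_op V) w f x"
  "mu_bar V (\<Sum>i\<in>I. R i) f x = (\<Sum>i\<in>I. mu_bar V (R i) f x)"
proof -
  have superset: "mu_bar V P f x = (\<Sum>w\<in>S. Poly_Mapping.lookup P w * foldr (letter_op V) w f x)"
    if "finite S" "Poly_Mapping.keys P \<subseteq> S" for P S
    unfolding mu_bar_def
    by (rule sum.mono_neutral_left) (use that in \<open>auto simp: in_keys_iff\<close>)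
  show add: "mu_bar V (P + Q) f x = mu_bar V P f x + mu_bar V Q f x" for P Q
    by (subst (1 2 3) superset[of "Poly_Mapping.keys P \<union> Poly_Mapping.keys Q"])
       (use Poly_Mapping.keys_add[of P Q] in \<open>auto simp: lookup_add algebra_simps sum.distrib\<close>)
  show "mu_bar V (Poly_Mapping.single w c) f x = c * foldr (letter_op V) w f x"
    by (simp add: mu_bar_def)
  show "mu_bar V (\<Sum>i\<in>I. R i) f x = (\<Sum>i\<in>I. mu_bar V (R i) f x)"
    by (induction I rule: infinite_finite_induct) (simp_all add: add, simp_all add: mu_bar_def)
qed

lemma mu_bar_bar0:
  assumes d: "d \<le> l" and a: "(i, m) \<in> alphabet d l"
  shows "mu_bar V (bar0 d l (i, m)) f x = (\<Sum>k=1..m. (- 1) ^ (k - 1) / real k *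
    (\<Sum>is\<in>compositions k m. foldr (letter_op V) (map (Pair i) is) f x))"
proof -
  let ?N = "{n. 1 \<le> n \<and> bracket_words d l n (i, m) \<noteq> {}}"
  have single: "scalar c * prod_list (map bar w) = Poly_Mapping.single w c" for c w
    by (simp add: prod_list_bar scalar_def mult_single plus_list_def)
  have "mu_bar V (bar0 d l (i, m)) f x = (\<Sum>n\<in>?N. \<Sum>w\<in>bracket_words d l n (i, m).
      (- 1) ^ (n - 1) / real n * foldr (letter_op V) w f x)"
    by (simp add: bar0_def sum_distrib_left single mu_bar_linear)
  also have "\<dots> = (\<Sum>n=1..m. \<Sum>w\<in>bracket_words d l n (i, m).
      (- 1) ^ (n - 1) / real n * foldr (letter_op V) w f x)"
    by (rule sum.mono_neutral_left) (use bracket_words_subset(1) in auto)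
  also have "\<dots> = (\<Sum>n=1..m. (- 1) ^ (n - 1) / real n *
      (\<Sum>is\<in>compositions n m. foldr (letter_op V) (map (Pair i) is) f x))"
    by (intro sum.cong refl)
       (auto simp: bracket_words_eq[OF d a] sum.reindex inj_on_def sum_distrib_left)
  finally show ?thesis .
qed

theorem theorem1:
  fixes d l i m :: nat and V :: "nat \<Rightarrow> real^'n \<Rightarrow> real^'n"
  assumes "d \<le> l"
    and "\<And>k. k \<le> l \<Longrightarrow> analytic_vfield (V k)"
    and "(i, m) \<in> alphabet d l"
  shows "is_vfield (mu_bar V (bar0 d l (i, m))) \<and>
    op_eq (mu_bar V (bar0 d l (i, m))) (vfield_op (magnus m (V i)))"
proof -
  have "i \<le> l" and m: "1 \<le> m"
    using assms(1,3) by (auto simp: alphabet_def)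
  then have V: "analytic_vfield (V i)" by (intro assms(2))
  note smooth = analytic_vfield_imp_smooth[OF V] analytic_vfield_imp_smooth[OF analytic_vfield_magnus[OF V]]
  have eq: "op_eq (mu_bar V (bar0 d l (i, m))) (vfield_op (magnus m (V i)))"
    unfolding op_eq_def
  proof (intro allI impI ext)
    fix f :: "real^'n \<Rightarrow> real" and x assume f: "smooth f"
    let ?a = "Smooth_fun f"
    have fun_of_a: "fun_of ?a = f" using f by (simp add: Smooth_fun_inverse)
    have log: "(\<Sum>k=1..m. of_real ((- 1) ^ (k - 1) / real k) *
        (\<Sum>is\<in>compositions k m. foldr (smooth_fun.taylor (component_funs (V i))) is ?a))
      = smooth_fun.along (component_funs (magnus m (V i))) ?a"
    proof (rule smooth_fun.log_taylor_eq_magnus[where \<mu> = "\<lambda>n. component_funs (magnus n (V i))"])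
      show "component_funs (magnus 1 (V i)) = component_funs (V i)"
        by (simp add: magnus.simps)
    qed (use component_funs_magnus[OF V] m in auto)
    have "mu_bar V (bar0 d l (i, m)) f x = fun_of (\<Sum>k=1..m. of_real ((- 1) ^ (k - 1) / real k) *
        (\<Sum>is\<in>compositions k m. foldr (smooth_fun.taylor (component_funs (V i))) is ?a)) x"
      unfolding mu_bar_bar0[OF assms(1,3)]
      by (simp add: fun_of_sum times_smooth_fun.rep_eq fun_of_of_real fun_of_foldr_taylor smooth fun_of_a del: of_real_divide of_real_power)
    also have "\<dots> = vfield_op (magnus m (V i)) f x"
      unfolding log by (simp add: fun_of_along smooth fun_of_a)
    finally show "mu_bar V (bar0 d l (i, m)) f x = vfield_op (magnus m (V i)) f x" .
  qed
  moreover have "is_vfield (mu_bar V (bar0 d l (i, m)))"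
    unfolding is_vfield_def using eq analytic_vfield_magnus[OF V] by blast
  ultimately show ?thesis by blast
qed

end
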